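(* Let $n$ be a positive integer and $\theta>0$. With the constants $C_{k,l}$ and the other notation given in the context, the following hold. (I) For $3\le i\le n-1$: $|R_{\theta,n;-i,-i;m}|=|R_{\theta,n;m}|$ for all $1\le m\le i-1$, and $$|R_{\theta,n;-i,-i;i}|=\frac{C_{7,1}(\tilde a\alpha_1+u^2\tilde b)}{\alpha_1-\alpha_2}[-(b+\tau_{-1}u)\alpha_1]^{i-3}-\frac{C_{7,2}(\tilde a\alpha_2+u^2\tilde b)}{\alpha_1-\alpha_2}[-(b+\tau_{-1}u)\alpha_2]^{i-3}.$$ (II) For $4\le i+1\le m\le n-1$: $$\begin{aligned}|R_{\theta,n;-i,-i;m}|={}&\frac{C_{1,1}\tau_{-1}u^4(\tilde a\alpha_1+u^2\tilde b)}{(\alpha_1-\alpha_2)^2}\Big\{(\alpha_1-u^2)[-(b+\tau_{-1}u)\alpha_1]^{m-4}-(\alpha_2-u^2)[-(b+\tau_{-1}u)\alpha_1]^{i-3}[-(b+\tau_{-1}u)\alpha_2]^{m-i-1}\Big\}\\ &-\frac{C_{1,2}\tau_{-1}u^4(\tilde a\alpha_2+u^2\tilde b)}{(\alpha_1-\alpha_2)^2}\Big\{(\alpha_1-u^2)[-(b+\tau_{-1}u)\alpha_1]^{m-i-1}[-(b+\tau_{-1}u)\alpha_2]^{i-3}-(\alpha_2-u^2)[-(b+\tau_{-1}u)\alpha_2]^{m-4}\Big\}\\ &+\frac{C_{2,1}\tau_{-1}u^6(\tilde a\alpha_1+u^2\tilde b)}{(\alpha_1-\alpha_2)^2}\Big\{[-(b+\tau_{-1}u)\alpha_1]^{m-4}-[-(b+\tau_{-1}u)\alpha_1]^{i-3}[-(b+\tau_{-1}u)\alpha_2]^{m-i-1}\Big\}\\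 &-\frac{C_{2,2}\tau_{-1}u^6(\tilde a\alpha_2+u^2\tilde b)}{(\alpha_1-\alpha_2)^2}\Big\{[-(b+\tau_{-1}u)\alpha_1]^{m-i-1}[-(b+\tau_{-1}u)\alpha_2]^{i-3}-[-(b+\tau_{-1}u)\alpha_2]^{m-4}\Big\}.\end{aligned}$$ (III) For $3\le i\le n-1$: $|R_{\theta,n;-i,-(i+1);m}|=|R_{\theta,n;m}|$ for all $1\le m\le i-1$, and $$|R_{\theta,n;-i,-(i+1);i}|=\frac{C_{3,1}(\tilde a\alpha_1+u^2\tilde b)}{\alpha_1-\alpha_2}[-(b+\tau_{-1}u)\alpha_1]^{i-3}-\frac{C_{3,2}(\tilde a\alpha_2+u^2\tilde b)}{\alpha_1-\alpha_2}[-(b+\tau_{-1}u)\alpha_2]^{i-3}.$$ (IV) For $4\le i+1\le m\le n-1$: $$\begin{aligned}|R_{\theta,n;-i,-(i+1);m}|={}&\frac{C_{4,1}\tau_{-1}u^4(\tilde a\alpha_1+u^2\tilde b)}{(\alpha_1-\alpha_2)^2}\Big\{(\alpha_1-u^2)[-(b+\tau_{-1}u)\alpha_1]^{m-4}-(\alpha_2-u^2)[-(b+\tau_{-1}u)\alpha_1]^{i-3}[-(b+\tau_{-1}u)\alpha_2]^{m-i-1}\Big\}\\ &-\frac{C_{4,2}\tau_{-1}u^4(\tilde a\alpha_2+u^2\tilde b)}{(\alpha_1-\alpha_2)^2}\Big\{(\alpha_1-u^2)[-(b+\tau_{-1}u)\alpha_1]^{m-i-1}[-(b+\tau_{-1}u)\alpha_2]^{i-3}-(\alpha_2-u^2)[-(b+\tau_{-1}u)\alpha_2]^{m-4}\Big\}\\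 &+\frac{C_{5,1}\tau_{-1}u^6(\tilde a\alpha_1+u^2\tilde b)}{(\alpha_1-\alpha_2)^2}\Big\{[-(b+\tau_{-1}u)\alpha_1]^{m-4}-[-(b+\tau_{-1}u)\alpha_1]^{i-3}[-(b+\tau_{-1}u)\alpha_2]^{m-i-1}\Big\}\\ &-\frac{C_{5,2}\tau_{-1}u^6(\tilde a\alpha_2+u^2\tilde b)}{(\alpha_1-\alpha_2)^2}\Big\{[-(b+\tau_{-1}u)\alpha_1]^{m-i-1}[-(b+\tau_{-1}u)\alpha_2]^{i-3}-[-(b+\tau_{-1}u)\alpha_2]^{m-4}\Big\}.\end{aligned}$$ (V) For $3\le i\le n-2$: $$|R_{\theta,n;-i,-n;n-1}|=\frac{C_{6,1}\tau_{-1}^{n-i-2}(\tilde a\alpha_1+u^2\tilde b)}{\alpha_1-\alpha_2}[-(b+\tau_{-1}u)\alpha_1]^{i-3}-\frac{C_{6,2}\tau_{-1}^{n-i-2}(\tilde a\alpha_2+u^2\tilde b)}{\alpha_1-\alpha_2}[-(b+\tau_{-1}u)\alpha_2]^{i-3}.$$ (VI) For $5\le i+2\le j\le n-1$: $$\begin{aligned}|R_{\theta,n;-i,-j;n-1}|={}&\frac{C_{6,1}\tau_{-1}^{j-i-2}(\tilde a\alpha_1+u^2\tilde b)}{(\alpha_1-\alpha_2)^2}\Big\{(a\alpha_1+u^2b)[-(b+\tau_{-1}u)\alpha_1]^{n-j+i-4}-(a\alpha_2+u^2b)[-(b+\tau_{-1}u)\alpha_1]^{i-3}[-(b+\tau_{-1}u)\alpha_2]^{n-j-1}\Big\}\\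 &-\frac{C_{6,2}\tau_{-1}^{j-i-2}(\tilde a\alpha_2+u^2\tilde b)}{(\alpha_1-\alpha_2)^2}\Big\{(a\alpha_1+u^2b)[-(b+\tau_{-1}u)\alpha_1]^{n-j-1}[-(b+\tau_{-1}u)\alpha_2]^{i-3}-(a\alpha_2+u^2b)[-(b+\tau_{-1}u)\alpha_2]^{n-j+i-4}\Big\}.\end{aligned}$$
   Context: Notation: $w=\theta/n$, $u=e^{-w}$. For $1\le m\le n$, $R_{\theta,n;m}$ is the $m\times m$ matrix with $(k,l)$th element $(1+|k-l|w)u^{|k-l|}$, and $R_{\theta,n}=R_{\theta,n;n}$. $R_{\theta,n;-i,-j}$ is obtained from $R_{\theta,n}$ by deleting row $i$ and column $j$; for $1\le m\le n-1$, $R_{\theta,n;-i,-j;m}$ is its leading $m\times m$ submatrix. $|M|$ is the determinant of $M$. $\tau_{-2}=0$, $\tau_{-1}=(w-1)u+(1+w)u^3$, $\tau_k=(1+kw)u^k-2[1+(k+1)w]u^{k+2}+[1+(k+2)w]u^{k+4}$ for $k\ge0$. $\hat\tau_{-2}=2\tau_{-1}u$, $\hat\tau_{-1}=(1+w)u-3(1+w)u^3+2(1+2w)u^5$, $\hat\tau_k=(1+kw)u^k-3(1+(k+2)w)u^{k+4}+2(1+(k+3)w)u^{k+6}$ for $k\ge0$. $\tilde\tau_{-2}=\tau_{-1}u/2$, $\tilde\tau_{-1}=\frac12[(2w-1)u+(1+2w)u^5]$, $\tilde\tau_k=\frac12[2(1+kw)u^k-3(1+(k+1)w)u^{k+2}+(1+(k+3)w)u^{k+6}]$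 for $k\ge0$. $a=1-2u^2+u^4-2u^2w+2u^4w$, $b=2u^2-u^4+w-u^4w-1$, $\tilde a=1-u^2-2u^2w-u^2w^2$, $\tilde b=u^2+w+u^2w-1$, $$\alpha_1=\frac{-(a-2\tau_{-1}u)-\sqrt{(a-2\tau_{-1}u)^2-4\tau_{-1}u(b+\tau_{-1}u)}}{2(b+\tau_{-1}u)},\quad \alpha_2=\frac{-(a-2\tau_{-1}u)+\sqrt{(a-2\tau_{-1}u)^2-4\tau_{-1}u(b+\tau_{-1}u)}}{2(b+\tau_{-1}u)}.$$ For $l=1,2$ write $X_l=(b+\tau_{-1}u)\alpha_l-\tau_{-1}u$. The constants are $$C_{1,l}=\frac{\hat\tau_{-2}\tilde\tau_0[w(2-6u^2+4u^4)+(1-u^2)^2]}{\tau_{-1}u^2X_l}+\frac{w\hat\tau_{-2}\tilde\tau_0(1-u^2)^2}{uX_l^2}+\frac{\hat\tau_0\tilde\tau_0-\hat\tau_1\tilde\tau_{-1}}{\tau_{-1}u^4}-\frac{\hat\tau_{-2}\tilde\tau_{-1}[w(3-8u^2+5u^4)+(1-u^2)^2]}{\tau_{-1}uX_l}-\frac{w\hat\tau_{-2}\tilde\tau_{-1}(1-u^2)^2}{X_l^2},$$ $$C_{2,l}=\frac{w\hat\tau_{-2}(2-3u^2+u^6)[w(2-6u^2+4u^4)+(1-u^2)^2]}{2\tau_{-1}u^2X_l}+\frac{w^2\hat\tau_{-2}(2-3u^2+u^6)(1-u^2)^2}{2uX_l^2}+\frac{w\hat\tau_0(2-3u^2+u^6)}{2\tau_{-1}u^4}-\frac{w(1-u^2)^2\hat\tau_{-2}\tilde\tau_{-1}}{\tau_{-1}uX_l}-\frac{w(1-3u^4+2u^6)\tilde\tau_{-1}}{\tau_{-1}u^3},$$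 $$C_{3,l}=\hat\tau_{-1}+\frac{\hat\tau_{-2}u[w(1-4u^2+3u^4)+(1-u^2)^2]}{X_l}+\frac{w\tau_{-1}u^2\hat\tau_{-2}(1-u^2)^2}{X_l^2},$$ $$C_{4,l}=\frac{\hat\tau_{-1}\tilde\tau_0}{\tau_{-1}u^4}+\frac{\hat\tau_{-2}\tilde\tau_0[w(1-4u^2+3u^4)+(1-u^2)^2]}{\tau_{-1}u^3X_l}+\frac{w\tau_{-1}\hat\tau_{-2}\tilde\tau_0(1-u^2)^2}{\tau_{-1}u^2X_l^2}-\frac{\hat\tau_1\tilde\tau_{-2}}{\tau_{-1}u^4}-\frac{\hat\tau_{-2}\tilde\tau_{-2}[w(3-8u^2+5u^4)+(1-u^2)^2]}{\tau_{-1}uX_l}-\frac{w\hat\tau_{-2}\tilde\tau_{-2}(1-u^2)^2}{X_l^2},$$ $$C_{5,l}=\frac{w\hat\tau_{-1}(2-3u^2+u^6)}{2\tau_{-1}u^4}+\frac{w\hat\tau_{-2}(2-3u^2+u^6)[w(1-4u^2+3u^4)+(1-u^2)^2]}{2\tau_{-1}u^3X_l}+\frac{w^2\hat\tau_{-2}(2-3u^2+u^6)(1-u^2)^2}{2u^2X_l^2}-\frac{w\hat\tau_{-2}\tilde\tau_{-2}(1-u^2)^2}{\tau_{-1}uX_l}-\frac{w(1-3u^4+2u^6)\tilde\tau_{-2}}{\tau_{-1}u^3},$$ $$C_{6,l}=\hat\tau_{-1}\tilde\tau_{-1}-\hat\tau_0\tilde\tau_{-2}+\frac{\hat\tau_{-2}u\tilde\tau_{-1}[w(1-4u^2+3u^4)+(1-u^2)^2]}{X_l}-\frac{\hat\tau_{-2}\tilde\tau_{-2}u^2[w(2-6u^2+4u^4)+(1-u^2)^2]}{X_l}+\frac{w\tau_{-1}u^2\hat\tau_{-2}(\tilde\tau_{-1}-u\tilde\tau_{-2})(1-u^2)^2}{X_l^2},$$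 $$C_{7,l}=\frac{\hat\tau_{-2}u^2[w(2-6u^2+4u^4)+(1-u^2)^2]}{X_l}+\frac{w\tau_{-1}\hat\tau_{-2}u^3(1-u^2)^2}{X_l^2}+\hat\tau_0.$$ *)

theory Defs
  imports Complex_Main "Jordan_Normal_Form.Determinant"
begin

definition leading_submat :: "nat \<Rightarrow> 'a mat \<Rightarrow> 'a mat" where
  "leading_submat m A = mat m m (\<lambda>(k, l). A $$ (k, l))"

text \<open>
  The locale carries no assumptions; it only makes all the quantities below depend on
  \<open>\<theta>\<close> and \<open>n\<close>.  Every quotient is division in the field of reals and
  \<open>sqrt\<close> is the real square root.
\<close>

locale matern32 =
  fixes \<theta> :: real and n :: nat
begin

definition w :: real where "w = \<theta> / real n"

definition u :: real where "u = exp (- w)"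

text \<open>
  Matrix indices start at 0 here, whereas rows and columns are numbered from 1 in the
  mathematical notation.  The entries of \<open>R m\<close> depend on \<open>\<bar>k - l\<bar>\<close> only and
  are not affected by the shift; the indices of the deleted row and column are shifted
  in \<open>R_del\<close>, so that \<open>R_del i j m\<close> has the 1-based meaning.
\<close>

definition R :: "nat \<Rightarrow> real mat" where
  "R m = mat m m (\<lambda>(k, l).
     (1 + of_int \<bar>int k - int l\<bar> * w) * u ^ nat \<bar>int k - int l\<bar>)"

definition R_del :: "nat \<Rightarrow> nat \<Rightarrow> nat \<Rightarrow> real mat" where
  "R_del i j m = leading_submat m (mat_delete (R n) (i - 1) (j - 1))"

text \<open>
  The three sequences are meant for \<open>k \<ge> -2\<close>; what the last branch gives for
  smaller \<open>k\<close> is never used.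
\<close>

definition tau :: "int \<Rightarrow> real" where
  "tau k =
    (if k = -2 then 0
     else if k = -1 then (w - 1) * u + (1 + w) * u ^ 3
     else (1 + of_int k * w) * u powi k
        - 2 * (1 + of_int (k + 1) * w) * u powi (k + 2)
        + (1 + of_int (k + 2) * w) * u powi (k + 4))"

definition tau_hat :: "int \<Rightarrow> real" where
  "tau_hat k =
    (if k = -2 then 2 * tau (-1) * u
     else if k = -1 then (1 + w) * u - 3 * (1 + w) * u ^ 3 + 2 * (1 + 2 * w) * u ^ 5
     else (1 + of_int k * w) * u powi k
        - 3 * (1 + of_int (k + 2) * w) * u powi (k + 4)
        + 2 * (1 + of_int (k + 3) * w) * u powi (k + 6))"

definition tau_tilde :: "int \<Rightarrow> real" where
  "tau_tilde k =
    (if k = -2 then tau (-1) * u / 2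
     else if k = -1 then 1 / 2 * ((2 * w - 1) * u + (1 + 2 * w) * u ^ 5)
     else 1 / 2 * (2 * (1 + of_int k * w) * u powi k
        - 3 * (1 + of_int (k + 1) * w) * u powi (k + 2)
        + (1 + of_int (k + 3) * w) * u powi (k + 6)))"

definition a :: real where
  "a = 1 - 2 * u ^ 2 + u ^ 4 - 2 * u ^ 2 * w + 2 * u ^ 4 * w"

definition b :: real where
  "b = 2 * u ^ 2 - u ^ 4 + w - u ^ 4 * w - 1"

definition a_tilde :: real where
  "a_tilde = 1 - u ^ 2 - 2 * u ^ 2 * w - u ^ 2 * w ^ 2"

definition b_tilde :: real where
  "b_tilde = u ^ 2 + w + u ^ 2 * w - 1"

definition \<alpha>1 :: real where
  "\<alpha>1 = (- (a - 2 * tau (-1) * u)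
          - sqrt ((a - 2 * tau (-1) * u) ^ 2 - 4 * tau (-1) * u * (b + tau (-1) * u)))
        / (2 * (b + tau (-1) * u))"

definition \<alpha>2 :: real where
  "\<alpha>2 = (- (a - 2 * tau (-1) * u)
          + sqrt ((a - 2 * tau (-1) * u) ^ 2 - 4 * tau (-1) * u * (b + tau (-1) * u)))
        / (2 * (b + tau (-1) * u))"

text \<open>
  The second index of \<open>X\<close> and of the constants \<open>C\<close> enters only through
  \<open>\<alpha>1\<close> or \<open>\<alpha>2\<close>, so these are functions of that number:
  \<open>C k 1\<close> of the mathematical notation is \<open>Ck \<alpha>1\<close>.
\<close>

definition X :: "real \<Rightarrow> real" where
  "X \<alpha> = (b + tau (-1) * u) * \<alpha> - tau (-1) * u"

definition C1 :: "real \<Rightarrow> real" where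
  "C1 \<alpha> =
      tau_hat (-2) * tau_tilde 0 * (w * (2 - 6 * u ^ 2 + 4 * u ^ 4) + (1 - u ^ 2) ^ 2)
        / (tau (-1) * u ^ 2 * X \<alpha>)
    + w * tau_hat (-2) * tau_tilde 0 * (1 - u ^ 2) ^ 2 / (u * X \<alpha> ^ 2)
    + (tau_hat 0 * tau_tilde 0 - tau_hat 1 * tau_tilde (-1)) / (tau (-1) * u ^ 4)
    - tau_hat (-2) * tau_tilde (-1) * (w * (3 - 8 * u ^ 2 + 5 * u ^ 4) + (1 - u ^ 2) ^ 2)
        / (tau (-1) * u * X \<alpha>)
    - w * tau_hat (-2) * tau_tilde (-1) * (1 - u ^ 2) ^ 2 / X \<alpha> ^ 2"

definition C2 :: "real \<Rightarrow> real" where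
  "C2 \<alpha> =
      w * tau_hat (-2) * (2 - 3 * u ^ 2 + u ^ 6)
        * (w * (2 - 6 * u ^ 2 + 4 * u ^ 4) + (1 - u ^ 2) ^ 2)
        / (2 * tau (-1) * u ^ 2 * X \<alpha>)
    + w ^ 2 * tau_hat (-2) * (2 - 3 * u ^ 2 + u ^ 6) * (1 - u ^ 2) ^ 2 / (2 * u * X \<alpha> ^ 2)
    + w * tau_hat 0 * (2 - 3 * u ^ 2 + u ^ 6) / (2 * tau (-1) * u ^ 4)
    - w * (1 - u ^ 2) ^ 2 * tau_hat (-2) * tau_tilde (-1) / (tau (-1) * u * X \<alpha>)
    - w * (1 - 3 * u ^ 4 + 2 * u ^ 6) * tau_tilde (-1) / (tau (-1) * u ^ 3)"

definition C3 :: "real \<Rightarrow> real" where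
  "C3 \<alpha> =
      tau_hat (-1)
    + tau_hat (-2) * u * (w * (1 - 4 * u ^ 2 + 3 * u ^ 4) + (1 - u ^ 2) ^ 2) / X \<alpha>
    + w * tau (-1) * u ^ 2 * tau_hat (-2) * (1 - u ^ 2) ^ 2 / X \<alpha> ^ 2"

definition C4 :: "real \<Rightarrow> real" where
  "C4 \<alpha> =
      tau_hat (-1) * tau_tilde 0 / (tau (-1) * u ^ 4)
    + tau_hat (-2) * tau_tilde 0 * (w * (1 - 4 * u ^ 2 + 3 * u ^ 4) + (1 - u ^ 2) ^ 2)
        / (tau (-1) * u ^ 3 * X \<alpha>)
    + w * tau (-1) * tau_hat (-2) * tau_tilde 0 * (1 - u ^ 2) ^ 2
        / (tau (-1) * u ^ 2 * X \<alpha> ^ 2)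
    - tau_hat 1 * tau_tilde (-2) / (tau (-1) * u ^ 4)
    - tau_hat (-2) * tau_tilde (-2) * (w * (3 - 8 * u ^ 2 + 5 * u ^ 4) + (1 - u ^ 2) ^ 2)
        / (tau (-1) * u * X \<alpha>)
    - w * tau_hat (-2) * tau_tilde (-2) * (1 - u ^ 2) ^ 2 / X \<alpha> ^ 2"

definition C5 :: "real \<Rightarrow> real" where
  "C5 \<alpha> =
      w * tau_hat (-1) * (2 - 3 * u ^ 2 + u ^ 6) / (2 * tau (-1) * u ^ 4)
    + w * tau_hat (-2) * (2 - 3 * u ^ 2 + u ^ 6)
        * (w * (1 - 4 * u ^ 2 + 3 * u ^ 4) + (1 - u ^ 2) ^ 2)
        / (2 * tau (-1) * u ^ 3 * X \<alpha>)
    + w ^ 2 * tau_hat (-2) * (2 - 3 * u ^ 2 + u ^ 6) * (1 - u ^ 2) ^ 2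
        / (2 * u ^ 2 * X \<alpha> ^ 2)
    - w * tau_hat (-2) * tau_tilde (-2) * (1 - u ^ 2) ^ 2 / (tau (-1) * u * X \<alpha>)
    - w * (1 - 3 * u ^ 4 + 2 * u ^ 6) * tau_tilde (-2) / (tau (-1) * u ^ 3)"

definition C6 :: "real \<Rightarrow> real" where
  "C6 \<alpha> =
      tau_hat (-1) * tau_tilde (-1) - tau_hat 0 * tau_tilde (-2)
    + tau_hat (-2) * u * tau_tilde (-1)
        * (w * (1 - 4 * u ^ 2 + 3 * u ^ 4) + (1 - u ^ 2) ^ 2) / X \<alpha>
    - tau_hat (-2) * tau_tilde (-2) * u ^ 2
        * (w * (2 - 6 * u ^ 2 + 4 * u ^ 4) + (1 - u ^ 2) ^ 2) / X \<alpha>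
    + w * tau (-1) * u ^ 2 * tau_hat (-2) * (tau_tilde (-1) - u * tau_tilde (-2))
        * (1 - u ^ 2) ^ 2 / X \<alpha> ^ 2"

definition C7 :: "real \<Rightarrow> real" where
  "C7 \<alpha> =
      tau_hat (-2) * u ^ 2 * (w * (2 - 6 * u ^ 2 + 4 * u ^ 4) + (1 - u ^ 2) ^ 2) / X \<alpha>
    + w * tau (-1) * tau_hat (-2) * u ^ 3 * (1 - u ^ 2) ^ 2 / X \<alpha> ^ 2
    + tau_hat 0"

end

end

theory Submission
  imports Defs
begin

text \<open>
  The correlation function \<open>k \<mapsto> (1 + k w) u ^ k\<close> solves the second-order linear recurrence
  with double characteristic root \<open>u\<close>, so the filter that sends a sequence \<open>g\<close> to
  \<open>g k - 2 u g (k - 1) + u^2 g (k - 2)\<close> annihilates it.  Filtering the rows and the columns of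
  the correlation matrix \<open>R\<close>, from the third on, is a congruence \<open>T R T^T\<close> by a unipotent
  matrix \<open>T\<close>, and its result is tridiagonal (lemma \<open>T_R_T\<close>): beyond a 2 by 2 corner it
  has the constant diagonal entry \<open>\<delta> = a - 2 t u\<close> and the constant off-diagonal entry
  \<open>t = tau (-1)\<close>.  This is the familiar fact that an autoregression of order two turns a
  Matern 3/2 process, observed on a grid, into a moving average of order one.

  Cofactors transform linearly under a congruence (\<open>cofactor_congruence\<close>).  From the third on, a
  column of \<open>T\<close> has the entries \<open>1\<close>, \<open>- 2 u\<close>, \<open>u^2\<close>, so a first minor of \<open>R\<close>
  is a combination of at most nine first minors of the tridiagonal matrix.  Each of those is a product
  \<open>D p * t ^ (q - p) * E (N - q)\<close> of a leading principal minor, a power of the off-diagonal entry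
  and a trailing principal minor (\<open>det_minor_hessenberg\<close>); altogether this is \<open>det_minor_R\<close>.
  Away from the corner, \<open>D\<close> and \<open>E\<close> both satisfy \<open>x (k + 2) = \<delta> x (k + 1) - t^2 x k\<close>.  Since
  \<open>b + t u = t / u\<close>, the numbers \<open>- (b + t u) \<alpha>l\<close> are the two characteristic roots
  \<open>\<rho>\<close> of this recurrence.  They are positive and distinct, because \<open>\<delta> > 2 t > 0\<close>, which comes
  down to \<open>sinh w > w > tanh w\<close>.  Thus \<open>D\<close> and \<open>E\<close> are combinations of powers of the roots.

  It remains to recognise the constants.  At a characteristic root the rational functions
  \<open>C1\<close>, ..., \<open>C7\<close> collapse, because \<open>w (1 - u^2)^2 / X\<close> is then linear in \<open>\<rho>\<close>
  (\<open>\<eta>_over_X\<close>): for example \<open>C3 = t + 2 u \<rho>\<close> and \<open>C6 = (t + u \<rho>)^2\<close>.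
  The values found are exactly the coefficients in the combinations of minors.
\<close>

section \<open>Minors of Hessenberg matrices and of congruent matrices\<close>


lemma det_mat_block_upper_triangular:
  fixes f :: "nat \<Rightarrow> nat \<Rightarrow> 'a::idom"
  assumes "\<And>i j. r \<le> i \<Longrightarrow> i < r + s \<Longrightarrow> j < r \<Longrightarrow> f i j = 0"
  shows "det (mat (r + s) (r + s) (\<lambda>(i, j). f i j))
    = det (mat r r (\<lambda>(i, j). f i j)) * det (mat s s (\<lambda>(i, j). f (i + r) (j + r)))"
proof -
  let ?A = "mat r r (\<lambda>(i, j). f i j)"
  let ?B = "mat r s (\<lambda>(i, j). f i (j + r))"
  let ?D = "mat s s (\<lambda>(i, j). f (i + r) (j + r))"
  have "mat (r + s) (r + s) (\<lambda>(i, j). f i j) = four_block_mat ?A ?B (0\<^sub>m s r) ?D"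
    using assms by (intro eq_matI) auto
  then show ?thesis
    by (simp add: det_four_block_mat_lower_left_zero[of ?A r ?B s "0\<^sub>m s r" ?D])
qed

text \<open>
  Without row \<open>p\<close> and column \<open>q\<close>, where \<open>p \<le> q\<close>, a Hessenberg matrix is block upper
  triangular: the rows and columns before \<open>p\<close>, then a triangular block that has the subdiagonal
  entries on its diagonal, then the rows and columns after \<open>q\<close>.
\<close>

lemma det_minor_hessenberg:
  fixes f :: "nat \<Rightarrow> nat \<Rightarrow> 'a::idom"
  assumes zero: "\<And>i j. Suc j < i \<Longrightarrow> f i j = 0" and pq: "p \<le> q" "q < N"
  shows "det (mat_delete (mat N N (\<lambda>(i, j). f i j)) p q)
    = det (mat p p (\<lambda>(i, j). f i j)) * (\<Prod>r = p..<q. f (Suc r) r)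
      * det (mat (N - Suc q) (N - Suc q) (\<lambda>(i, j). f (i + Suc q) (j + Suc q)))"
proof -
  define g where "g i j = f (if i < p then i else Suc i) (if j < q then j else Suc j)" for i j
  define s where "s = N - Suc q"
  define d where "d = q - p"
  have N: "N - 1 = p + (d + s)" and q: "q = p + d"
    using pq by (auto simp: s_def d_def)
  \<comment> \<open>The three diagonal blocks have the sizes \<open>p\<close>, \<open>d\<close> and \<open>s\<close>.\<close>
  have "mat_delete (mat N N (\<lambda>(i, j). f i j)) p q = mat (p + (d + s)) (p + (d + s)) (\<lambda>(i, j). g i j)"
    unfolding N[symmetric] by (intro eq_matI) (auto simp: mat_delete_def g_def)
  also have "det \<dots> = det (mat p p (\<lambda>(i, j). g i j))
      * det (mat (d + s) (d + s) (\<lambda>(i, j). g (i + p) (j + p)))"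
    by (rule det_mat_block_upper_triangular) (use pq in \<open>auto simp: g_def intro!: zero\<close>)
  also have "mat p p (\<lambda>(i, j). g i j) = mat p p (\<lambda>(i, j). f i j)"
    using pq by (intro eq_matI) (auto simp: g_def)
  also have "det (mat (d + s) (d + s) (\<lambda>(i, j). g (i + p) (j + p)))
      = det (mat d d (\<lambda>(i, j). g (i + p) (j + p)))
        * det (mat s s (\<lambda>(i, j). g (i + d + p) (j + d + p)))"
    by (rule det_mat_block_upper_triangular) (auto simp: g_def q intro!: zero)
  also have "mat s s (\<lambda>(i, j). g (i + d + p) (j + d + p)) = mat s s (\<lambda>(i, j). f (i + Suc q) (j + Suc q))"
    by (intro eq_matI) (auto simp: g_def q ac_simps)
  also have "det (mat d d (\<lambda>(i, j). g (i + p) (j + p))) = (\<Prod>r = p..<q. f (Suc r) r)"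
  proof -
    let ?M = "mat d d (\<lambda>(i, j). g (i + p) (j + p))"
    have "det ?M = prod_list (diag_mat ?M)"
      by (rule det_upper_triangular[of _ d]) (auto simp: upper_triangular_def g_def q intro!: zero)
    also have "\<dots> = (\<Prod>r = 0..<d. f (Suc (r + p)) (r + p))"
      unfolding diag_mat_def prod.distinct_set_conv_list[OF distinct_upt, symmetric]
      by (auto simp: g_def q prod.distinct_set_conv_list[symmetric] intro!: prod.cong)
    also have "\<dots> = (\<Prod>r = p..<q. f (Suc r) r)"
      using prod.shift_bounds_nat_ivl[of "\<lambda>r. f (Suc r) r" 0 p d] by (simp add: q add.commute)
    finally show ?thesis .
  qed
  finally show ?thesis by (simp add: s_def mult.assoc)
qed

text \<open>
  The three-term recurrence for continuants: only two entries of the last column are nonzero, and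
  \<open>det_minor_hessenberg\<close> evaluates both of their cofactors.
\<close>

lemma det_tridiagonal_rec:
  fixes f :: "nat \<Rightarrow> nat \<Rightarrow> 'a::idom"
  assumes zero: "\<And>i j. Suc j < i \<or> Suc i < j \<Longrightarrow> f i j = 0"
  defines "d \<equiv> \<lambda>k. det (mat k k (\<lambda>(i, j). f i j))"
  shows "d (Suc (Suc k)) = f (Suc k) (Suc k) * d (Suc k) - f k (Suc k) * f (Suc k) k * d k"
proof -
  let ?M = "mat (Suc (Suc k)) (Suc (Suc k)) (\<lambda>(i, j). f i j)"
  have minor: "det (mat_delete ?M p (Suc k)) = d p * (\<Prod>r = p..<Suc k. f (Suc r) r)"
    if "p \<le> Suc k" for p
    unfolding d_def using that by (subst det_minor_hessenberg) (auto simp: zero)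
  have "d (Suc (Suc k)) = (\<Sum>i<Suc (Suc k). ?M $$ (i, Suc k) * cofactor ?M i (Suc k))"
    unfolding d_def by (rule laplace_expansion_column) auto
  also have "\<dots> = (\<Sum>i\<in>{k, Suc k}. ?M $$ (i, Suc k) * cofactor ?M i (Suc k))"
    by (rule sum.mono_neutral_right) (auto simp: zero)
  also have "\<dots> = f (Suc k) (Suc k) * d (Suc k) - f k (Suc k) * f (Suc k) k * d k"
    by (simp add: cofactor_def minor)
  finally show ?thesis .
qed

text \<open>
  Bordering turns a bilinear form in the cofactors into one determinant.  The sign arises because
  the two expansions, along the last column and then along the last row, have shifted positions.
\<close>

lemma det_bordered:
  fixes A :: "'a::comm_ring_1 mat"
  assumes A: "A \<in> carrier_mat N N" and x: "x \<in> carrier_mat N 1" and y: "y \<in> carrier_mat 1 N"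
  shows "det (four_block_mat A x y (0\<^sub>m 1 1))
    = - (\<Sum>p<N. \<Sum>q<N. x $$ (p, 0) * y $$ (0, q) * cofactor A p q)"
proof (cases N)
  case 0
  then show ?thesis
    using A by (subst det_single) auto
next
  case (Suc M)
  let ?B = "four_block_mat A x y (0\<^sub>m 1 1)"
  have minor: "det (mat_delete ?B p N) = (\<Sum>q<N. y $$ (0, q) * ((-1) ^ (M + q) * det (mat_delete A p q)))"
    if p: "p < N" for p
  proof -
    let ?P = "mat_delete ?B p N"
    have "det ?P = (\<Sum>q<N. ?P $$ (M, q) * cofactor ?P M q)"
      by (rule laplace_expansion_row) (use A Suc in \<open>auto simp: mat_delete_def\<close>)
    also have "\<dots> = (\<Sum>q<N. y $$ (0, q) * ((-1) ^ (M + q) * det (mat_delete A p q)))"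
    proof (rule sum.cong[OF refl], goal_cases)
      case (1 q)
      have "mat_delete ?P M q = mat_delete A p q"
        using carrier_matD[OF A] p 1 Suc by (intro eq_matI) (simp_all add: mat_delete_def)
      moreover have "?P $$ (M, q) = y $$ (0, q)"
        using A x y p 1 Suc by (auto simp: mat_delete_def)
      ultimately show ?case by (simp add: cofactor_def)
    qed
    finally show ?thesis .
  qed
  have "det ?B = (\<Sum>p<Suc N. ?B $$ (p, N) * cofactor ?B p N)"
    by (rule laplace_expansion_column) (use A in auto)
  also have "\<dots> = (\<Sum>p<N. x $$ (p, 0) * cofactor ?B p N)"
  proof -
    have "?B $$ (N, N) = 0" and "\<And>p. p < N \<Longrightarrow> ?B $$ (p, N) = x $$ (p, 0)"
      using A x y by auto
    then show ?thesis by simp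
  qed
  also have "\<dots> = (\<Sum>p<N. - (\<Sum>q<N. x $$ (p, 0) * y $$ (0, q) * cofactor A p q))"
  proof (rule sum.cong[OF refl], goal_cases)
    case (1 p)
    have sign: "(-1) ^ (p + N) * (-1) ^ (M + q) = - ((-1) ^ (p + q) :: 'a)" for q
      by (simp add: Suc power_add mult_ac flip: power_mult_distrib)
    have "x $$ (p, 0) * cofactor ?B p N
        = (\<Sum>q<N. x $$ (p, 0) * y $$ (0, q) * (((-1) ^ (p + N) * (-1) ^ (M + q)) * det (mat_delete A p q)))"
      using 1 unfolding cofactor_def by (subst minor) (simp_all only: lessThan_iff sum_distrib_left mult_ac)
    then show ?case
      unfolding sign by (simp add: cofactor_def sum_negf)
  qed
  finally show ?thesis by (simp add: sum_negf)
qed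

text \<open>
  The rule \<open>adj (P A Q) = adj Q * adj A * adj P\<close>, freed of the adjugates of \<open>P\<close> and \<open>Q\<close>.
  For unit vectors as border the bordered determinant is a single cofactor up to sign, and
  multiplication by \<open>P\<close> and \<open>Q\<close>, extended by a trailing 1, replaces the border by a column of
  \<open>P\<close> and a row of \<open>Q\<close>.
\<close>

lemma cofactor_congruence:
  fixes A :: "'a::idom mat"
  assumes A: "A \<in> carrier_mat N N" and P: "P \<in> carrier_mat N N" and Q: "Q \<in> carrier_mat N N"
    and ij: "i < N" "j < N"
  shows "det P * det Q * cofactor A i j
    = (\<Sum>p<N. \<Sum>q<N. P $$ (p, i) * Q $$ (j, q) * cofactor (P * A * Q) p q)"
proof -
  let ?x = "mat N 1 (\<lambda>(p, _). if p = i then 1 else 0) :: 'a mat"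
  let ?y = "mat 1 N (\<lambda>(_, q). if q = j then 1 else 0) :: 'a mat"
  let ?ext = "\<lambda>M :: 'a mat. four_block_mat M (0\<^sub>m N 1) (0\<^sub>m 1 N) (1\<^sub>m 1)"
  let ?B = "four_block_mat A ?x ?y (0\<^sub>m 1 1)"
  have ext: "det (?ext M) = det M" "?ext M \<in> carrier_mat (N + 1) (N + 1)"
    if "M \<in> carrier_mat N N" for M
    using that by (auto simp: det_four_block_mat_lower_left_zero[of M N _ 1])
  have Px: "P * ?x = mat N 1 (\<lambda>(p, _). P $$ (p, i))"
    using P ij by (intro eq_matI) (auto simp: scalar_prod_def if_distrib cong: if_cong)
  have yQ: "?y * Q = mat 1 N (\<lambda>(_, q). Q $$ (j, q))"
    using Q ij by (intro eq_matI) (auto simp: scalar_prod_def if_distrib if_distribR cong: if_cong)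
  have 1: "?ext P * ?B = four_block_mat (P * A) (P * ?x) ?y (0\<^sub>m 1 1)"
    using A P by (subst mult_four_block_mat[of P N N _ 1 _ 1 _ _ N _ 1]) (auto)
  have 2: "?ext P * ?B * ?ext Q = four_block_mat (P * A * Q) (P * ?x) (?y * Q) (0\<^sub>m 1 1)"
    unfolding 1 using A P Q by (subst mult_four_block_mat[of _ N N _ 1 _ 1 _ _ N _ 1]) auto
  have "- (det P * det Q * cofactor A i j) = det P * det ?B * det Q"
  proof -
    have "(\<Sum>p<N. \<Sum>q<N. ?x $$ (p, 0) * ?y $$ (0, q) * cofactor A p q)
        = (\<Sum>p<N. if p = i then \<Sum>q<N. if q = j then cofactor A p q else 0 else 0)"
      by (intro sum.cong refl) (auto simp: if_distrib[of "\<lambda>c. c * _"] cong: if_cong)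
    also have "\<dots> = cofactor A i j"
      using ij by simp
    finally show ?thesis
      using det_bordered[OF A, of ?x ?y] by simp
  qed
  also have "\<dots> = det (?ext P * ?B * ?ext Q)"
  proof -
    have B: "?B \<in> carrier_mat (N + 1) (N + 1)"
      using A by auto
    show ?thesis
      unfolding det_mult[OF mult_carrier_mat[OF ext(2)[OF P] B] ext(2)[OF Q]]
        det_mult[OF ext(2)[OF P] B] ext(1)[OF P] ext(1)[OF Q] ..
  qed
  also have "\<dots> = - (\<Sum>p<N. \<Sum>q<N. P $$ (p, i) * Q $$ (j, q) * cofactor (P * A * Q) p q)"
    unfolding 2 Px yQ using A P Q by (subst det_bordered[of _ N]) simp_all
  finally show ?thesis by simp
qed

section \<open>The parameters and the characteristic roots\<close>

locale matern32_pos = matern32 +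
  assumes n_pos: "0 < n" and \<theta>_pos: "0 < \<theta>"
begin

abbreviation t :: real where "t \<equiv> tau (-1)"

definition \<delta> :: real where "\<delta> = a - 2 * t * u"

definition \<rho> :: "real \<Rightarrow> real" where "\<rho> \<alpha> = - ((b + t * u) * \<alpha>)"

lemma w_pos: "0 < w"
  using n_pos \<theta>_pos by (simp add: w_def)

lemma u_pos: "0 < u"
  by (simp add: u_def)

lemma t_eq: "t = (w - 1) * u + (1 + w) * u ^ 3"
  by (simp add: tau_def)

text \<open>
  \<open>t / u\<close> is the value at \<open>w\<close> of an increasing function that vanishes at 0; the inequality is
  equivalent to \<open>tanh w < w\<close>.
\<close>

lemma t_pos: "0 < t"
proof -
  let ?f = "\<lambda>x::real. (x - 1) + (1 + x) * exp (- 2 * x)"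
  have "?f 0 < ?f w"
  proof (rule DERIV_pos_imp_increasing_open[OF w_pos])
    fix x :: real
    assume x: "0 < x" "x < w"
    have "(?f has_real_derivative 1 - (1 + 2 * x) * exp (- 2 * x)) (at x)"
      by (auto intro!: derivative_eq_intros simp: algebra_simps)
    moreover have "(1 + 2 * x) * exp (- 2 * x) < exp (2 * x) * exp (- 2 * x)"
      using x exp_minus_greater[of "- (2 * x)"] by (intro mult_strict_right_mono) auto
    ultimately show "\<exists>y. (?f has_real_derivative y) (at x) \<and> 0 < y"
      by (auto simp flip: exp_add)
  qed (auto intro!: continuous_intros)
  also have "exp (- 2 * w) = u ^ 2"
    by (simp add: u_def flip: exp_of_nat_mult)
  finally have "0 < u * ((w - 1) + (1 + w) * u ^ 2)"
    using u_pos by simp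
  also have "\<dots> = t"
    by (simp add: t_eq algebra_simps power2_eq_square power3_eq_cube)
  finally show ?thesis .
qed

text \<open>
  This is \<open>sinh w > w\<close>, multiplied by \<open>2 u\<close>.
\<close>

lemma discriminant_factor_pos: "0 < 1 - u ^ 2 - 2 * w * u"
proof -
  let ?f = "\<lambda>x::real. exp x - exp (- x) - 2 * x"
  have "?f 0 < ?f w"
  proof (rule DERIV_pos_imp_increasing_open[OF w_pos])
    fix x :: real
    assume x: "0 < x" "x < w"
    have "(?f has_real_derivative exp x + exp (- x) - 2) (at x)"
      by (auto intro!: derivative_eq_intros)
    moreover have "exp x + exp (- x) - 2 = (exp (x / 2) - exp (- x / 2)) ^ 2"
      by (simp add: power2_diff flip: exp_of_nat_mult exp_add)
    moreover have "\<dots> > 0"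
      using x by simp
    ultimately show "\<exists>y. (?f has_real_derivative y) (at x) \<and> 0 < y"
      by auto
  qed (auto intro!: continuous_intros)
  then have "0 < u * (exp w - u - 2 * w)"
    using u_pos by (simp add: u_def)
  also have "\<dots> = 1 - u ^ 2 - 2 * w * u"
    by (simp add: u_def algebra_simps power2_eq_square flip: exp_add)
  finally show ?thesis .
qed

lemma \<delta>_eq: "\<delta> = 1 - u ^ 4 - 4 * w * u ^ 2"
  by (simp add: \<delta>_def a_def t_eq algebra_simps eval_nat_numeral)

lemma two_t_less_\<delta>: "2 * t < \<delta>"
proof -
  have "\<delta> - 2 * t = (1 - u ^ 2 - 2 * w * u) * (1 + u) ^ 2"
    unfolding \<delta>_eq t_eq by (simp add: algebra_simps eval_nat_numeral)
  also have "\<dots> > 0"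
    using discriminant_factor_pos u_pos by simp
  finally show ?thesis by simp
qed

lemma b_eq: "b + t * u = t / u" and b_tilde_eq: "b_tilde = t / u"
  using u_pos by (simp_all add: b_def b_tilde_def t_eq field_simps eval_nat_numeral)

lemma \<rho>_eq: "\<rho> \<alpha> = - (t / u * \<alpha>)"
  by (simp add: \<rho>_def b_eq)

lemma discriminant_pos: "0 < \<delta> ^ 2 - 4 * t ^ 2"
proof -
  have "0 < (\<delta> - 2 * t) * (\<delta> + 2 * t)"
    using two_t_less_\<delta> t_pos by (intro mult_pos_pos) linarith+
  then show ?thesis by (simp add: algebra_simps power2_eq_square)
qed

text \<open>
  As \<open>b + t u = t / u\<close>, the quadratic equation of the \<open>\<alpha>\<close> becomes \<open>x^2 - \<delta> x + t^2 = 0\<close>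
  in the variable \<open>\<rho>\<close>; this is the characteristic equation of the tridiagonal recurrence.
\<close>

lemma \<rho>_roots:
  defines "s \<equiv> sqrt (\<delta> ^ 2 - 4 * t ^ 2)"
  shows "\<rho> \<alpha>1 = (\<delta> + s) / 2" "\<rho> \<alpha>2 = (\<delta> - s) / 2"
proof -
  have "4 * t * u * (b + t * u) = 4 * t ^ 2"
    using u_pos by (simp add: b_eq power2_eq_square)
  then have "\<alpha>1 = (- \<delta> - s) / (2 * (t / u))" "\<alpha>2 = (- \<delta> + s) / (2 * (t / u))"
    unfolding \<alpha>1_def \<alpha>2_def \<delta>_def[symmetric] s_def by (simp_all add: b_eq)
  then show "\<rho> \<alpha>1 = (\<delta> + s) / 2" "\<rho> \<alpha>2 = (\<delta> - s) / 2"
    using t_pos u_pos by (simp_all add: \<rho>_eq field_simps)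
qed

lemma \<rho>_sum: "\<rho> \<alpha>1 + \<rho> \<alpha>2 = \<delta>"
  by (simp add: \<rho>_roots add_divide_distrib diff_divide_distrib)

lemma \<rho>_prod: "\<rho> \<alpha>1 * \<rho> \<alpha>2 = t ^ 2"
  using discriminant_pos by (simp add: \<rho>_roots field_simps power2_eq_square)

lemma \<rho>_neq: "\<rho> \<alpha>1 \<noteq> \<rho> \<alpha>2"
  using discriminant_pos by (simp add: \<rho>_roots)

lemma \<alpha>_neq: "\<alpha>1 \<noteq> \<alpha>2"
  using \<rho>_neq by auto

lemma \<rho>_pos: "0 < \<rho> \<alpha>1" "0 < \<rho> \<alpha>2"
proof -
  have "0 < \<delta> + sqrt (\<delta> ^ 2 - 4 * t ^ 2)"
    using two_t_less_\<delta> t_pos discriminant_pos by (intro add_pos_nonneg) auto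
  then show 1: "0 < \<rho> \<alpha>1" by (simp add: \<rho>_roots)
  then show "0 < \<rho> \<alpha>2"
    using \<rho>_prod t_pos by (metis zero_less_mult_pos zero_less_power)
qed

text \<open>
  Either of \<open>\<alpha>1\<close> and \<open>\<alpha>2\<close>, as far as the evaluation of the constants is concerned.  The
  sign of \<open>\<rho>\<close> keeps \<open>X \<alpha> = - (\<rho> \<alpha> + t u)\<close> away from 0.
\<close>

definition char_root :: "real \<Rightarrow> bool" where
  "char_root \<alpha> \<longleftrightarrow> \<rho> \<alpha> ^ 2 = \<delta> * \<rho> \<alpha> - t ^ 2 \<and> 0 < \<rho> \<alpha>"

lemma char_root_\<alpha>: "char_root \<alpha>1" "char_root \<alpha>2"
  using \<rho>_pos \<rho>_prod
  by (simp_all add: char_root_def flip: \<rho>_sum \<rho>_prod)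
     (simp_all add: algebra_simps power2_eq_square)

section \<open>Reduction of the correlation matrix to tridiagonal form\<close>

definition corr :: "nat \<Rightarrow> nat \<Rightarrow> real" where
  "corr k l = (1 + of_int \<bar>int k - int l\<bar> * w) * u ^ nat \<bar>int k - int l\<bar>"

text \<open>
  The square of the shift filter \<open>1 - u S\<close>, which annihilates \<open>k \<mapsto> (x + k z) u ^ k\<close>.
  The first two entries have fewer than two predecessors and stay as they are.
\<close>

definition filt :: "(nat \<Rightarrow> real) \<Rightarrow> nat \<Rightarrow> real" where
  "filt g k = (if k < 2 then g k else g k - 2 * u * g (k - 1) + u ^ 2 * g (k - 2))"

definition T :: "nat \<Rightarrow> real mat" where
  "T N = mat N N (\<lambda>(k, c). if c = k then 1 else if 2 \<le> k \<and> Suc c = k then - 2 * u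
     else if 2 \<le> k \<and> c + 2 = k then u ^ 2 else 0)"

text \<open>
  The entries of the filtered correlation matrix, as \<open>T_R_T\<close> shows.
\<close>

definition \<kappa> :: "nat \<Rightarrow> nat \<Rightarrow> real" where
  "\<kappa> k l = (if k = l then (if k < 2 then 1 else \<delta>)
     else if Suc k = l \<or> Suc l = k then (if k = 0 \<or> l = 0 then (1 + w) * u else t) else 0)"

lemma T_carrier [simp]: "T N \<in> carrier_mat N N" "dim_row (T N) = N" "dim_col (T N) = N"
  by (simp_all add: T_def)

lemma R_carrier [simp]: "R N \<in> carrier_mat N N" "dim_row (R N) = N" "dim_col (R N) = N"
  by (simp_all add: R_def)

lemma R_index: "k < N \<Longrightarrow> l < N \<Longrightarrow> R N $$ (k, l) = corr k l"
  by (simp add: R_def corr_def)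

lemma det_T: "det (T N) = 1"
proof -
  have "det (T N) = prod_list (diag_mat (T N))"
    by (rule det_lower_triangular[of N]) (auto simp: T_def)
  also have "diag_mat (T N) = replicate N 1"
    by (auto simp: diag_mat_def T_def intro!: nth_equalityI)
  finally show ?thesis by simp
qed

lemma T_sum: "k < N \<Longrightarrow> (\<Sum>c<N. T N $$ (k, c) * g c) = filt g k"
proof -
  assume k: "k < N"
  show ?thesis
  proof (cases "k < 2")
    case True
    have "(\<Sum>c<N. T N $$ (k, c) * g c) = (\<Sum>c\<in>{k}. T N $$ (k, c) * g c)"
      using k True by (intro sum.mono_neutral_right) (auto simp: T_def)
    then show ?thesis using k True by (simp add: T_def filt_def)
  next
    case False
    then obtain m where m: "k = m + 2" by (metis add.commute le_Suc_ex not_less)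
    have "(\<Sum>c<N. T N $$ (k, c) * g c) = (\<Sum>c\<in>{m, Suc m, m + 2}. T N $$ (k, c) * g c)"
      using k m by (intro sum.mono_neutral_right) (auto simp: T_def)
    then show ?thesis using k m by (simp add: T_def filt_def)
  qed
qed

lemma corr_sym: "corr k l = corr l k"
  by (simp add: corr_def abs_minus_commute)

lemma corr_add: "corr k (k + m) = (1 + m * w) * u ^ m" "corr (k + m) k = (1 + m * w) * u ^ m"
  by (simp_all add: corr_def)

lemma filt_sym: "filt (\<lambda>c. filt (\<lambda>d. corr c d) l) k = filt (\<lambda>c. filt (\<lambda>d. corr c d) k) l"
proof -
  have "filt (\<lambda>c. filt (\<lambda>d. corr c d) l) k = filt (\<lambda>d. filt (\<lambda>c. corr c d) k) l"
    by (simp add: filt_def algebra_simps)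
  also have "(\<lambda>d. filt (\<lambda>c. corr c d) k) = (\<lambda>d. filt (\<lambda>c. corr d c) k)"
    by (subst corr_sym) (rule refl)
  finally show ?thesis .
qed

lemma filt_corr_diag: "filt (corr c) c = (if c < 2 then 1 else a)"
proof (cases "c < 2")
  case False
  then obtain m where m: "c = m + 2" by (metis add.commute le_Suc_ex not_less)
  show ?thesis
    using corr_add(1)[of c 0] corr_add(2)[of "m + 1" 1] corr_add(2)[of m 2]
    by (simp add: m filt_def a_def algebra_simps eval_nat_numeral)
qed (simp add: filt_def corr_def)

lemma filt_corr_above: "filt (corr c) (Suc c) = (if c = 0 then (1 + w) * u else t)"
proof (cases c)
  case (Suc m)
  show ?thesis
    using corr_add(1)[of c 0] corr_add(1)[of c 1] corr_add(2)[of m 1]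
    by (simp add: Suc filt_def t_eq algebra_simps eval_nat_numeral)
qed (simp add: filt_def corr_def)

lemma filt_corr_far: "c + 2 \<le> l \<Longrightarrow> filt (corr c) l = 0"
proof -
  assume "c + 2 \<le> l"
  then obtain m where m: "l = c + m + 2" by (metis add.assoc add.commute le_Suc_ex)
  show ?thesis
    using corr_add(1)[of c m] corr_add(1)[of c "m + 1"] corr_add(1)[of c "m + 2"]
    by (simp add: m filt_def add.assoc) (simp add: algebra_simps eval_nat_numeral)
qed

text \<open>
  Filtering along the columns already clears everything above the first superdiagonal.  Filtering
  along the rows leaves these zeros in place and changes the diagonal, from the third
  entry on, from \<open>a\<close> to \<open>a - 2 t u\<close>.  The part below the diagonal follows by symmetry.
\<close>

lemma filt_filt_corr: "filt (\<lambda>c. filt (\<lambda>d. corr c d) l) k = \<kappa> k l"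
proof -
  have le: "filt (\<lambda>c. filt (\<lambda>d. corr c d) l) k = \<kappa> k l" if "k \<le> l" for k l
  proof -
    consider "l = k" | "l = Suc k" | "k + 2 \<le> l" using \<open>k \<le> l\<close> by linarith
    then show ?thesis
    proof cases
      case 1
      show ?thesis
      proof (cases "k < 2")
        case True
        then show ?thesis
          using 1 filt_corr_diag[of k] by (simp add: \<kappa>_def) (simp add: filt_def)
      next
        case False
        then obtain m where m: "k = m + 2" by (metis add.commute le_Suc_ex not_less)
        show ?thesis
          using 1 filt_corr_diag[of k] filt_corr_above[of "Suc m"] filt_corr_far[of m k]
          by (simp add: m filt_def[of "\<lambda>c. filt (corr c) _"] \<kappa>_def \<delta>_def)
      qed
    next
      case 2
      then show ?thesis
        using filt_corr_above[of k] filt_corr_far[of "k - 1" l] filt_corr_far[of "k - 2" l]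
        by (auto simp: filt_def[of "\<lambda>c. filt (corr c) _"] \<kappa>_def)
    next
      case 3
      then show ?thesis
        using filt_corr_far[of k l] filt_corr_far[of "k - 1" l] filt_corr_far[of "k - 2" l]
        by (auto simp: filt_def[of "\<lambda>c. filt (corr c) _"] \<kappa>_def)
    qed
  qed
  show ?thesis
  proof (cases "k \<le> l")
    case False
    then have "filt (\<lambda>c. filt (\<lambda>d. corr c d) l) k = \<kappa> l k"
      using le[of l k] by (simp add: filt_sym)
    then show ?thesis by (auto simp: \<kappa>_def)
  qed (rule le)
qed

lemma T_R_T: "T N * R N * transpose_mat (T N) = mat N N (\<lambda>(k, l). \<kappa> k l)"
proof (rule eq_matI)
  fix k l assume "k < dim_row (mat N N (\<lambda>(k, l). \<kappa> k l))" "l < dim_col (mat N N (\<lambda>(k, l). \<kappa> k l))"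
  then have kl: "k < N" "l < N" by auto
  have "(T N * (R N * transpose_mat (T N))) $$ (k, l)
      = (\<Sum>c<N. T N $$ (k, c) * (R N * transpose_mat (T N)) $$ (c, l))"
    using kl by (simp add: scalar_prod_def lessThan_atLeast0)
  also have "\<dots> = (\<Sum>c<N. T N $$ (k, c) * filt (corr c) l)"
  proof (rule sum.cong[OF refl], goal_cases)
    case (1 c)
    have "(R N * transpose_mat (T N)) $$ (c, l) = (\<Sum>d<N. T N $$ (l, d) * corr c d)"
      using kl 1 by (simp add: scalar_prod_def lessThan_atLeast0 R_index mult.commute)
    then show ?case using kl by (simp add: T_sum)
  qed
  also have "\<dots> = \<kappa> k l"
    using kl by (simp add: T_sum filt_filt_corr)
  finally show "(T N * R N * transpose_mat (T N)) $$ (k, l) = mat N N (\<lambda>(k, l). \<kappa> k l) $$ (k, l)"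
    using kl by (simp add: assoc_mult_mat[of _ N N _ N _ N])
qed auto

definition D :: "nat \<Rightarrow> real" where "D k = det (R k)"

lemma D_eq: "D k = det (mat k k (\<lambda>(i, j). \<kappa> i j))"
proof -
  have "det (mat k k (\<lambda>(i, j). \<kappa> i j)) = det (T k) * det (R k) * det (transpose_mat (T k))"
    unfolding T_R_T[symmetric]
    by (subst det_mult[of _ k] | simp add: mult_carrier_mat[of _ k k])+
  then show ?thesis
    by (simp add: D_def det_T det_transpose[of _ k])
qed

lemma \<kappa>_far: "Suc j < i \<or> Suc i < j \<Longrightarrow> \<kappa> i j = 0"
  by (auto simp: \<kappa>_def)

lemma D_rec: "D (Suc (Suc k)) = \<kappa> (Suc k) (Suc k) * D (Suc k) - \<kappa> k (Suc k) * \<kappa> (Suc k) k * D k"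
  unfolding D_eq by (rule det_tridiagonal_rec) (rule \<kappa>_far)

lemma D_base: "D 0 = 1" "D 1 = 1" "D 2 = a_tilde"
proof -
  show 0: "D 0 = 1" by (simp add: D_def)
  show 1: "D 1 = 1"
    unfolding D_def by (subst det_single) (auto simp: R_def)
  show "D 2 = a_tilde"
    using D_rec[of 0] 0 1 by (simp add: \<kappa>_def a_tilde_def algebra_simps eval_nat_numeral)
qed

lemma D_step: "1 \<le> k \<Longrightarrow> D (k + 2) = \<delta> * D (k + 1) - t ^ 2 * D k"
  using D_rec[of k] by (simp add: \<kappa>_def power2_eq_square)

text \<open>
  \<open>E (Suc k)\<close> is the determinant of the tridiagonal Toeplitz matrix of size \<open>k\<close>.  The shift by
  one makes room for \<open>E 0 = 0\<close>, which stands for a minor whose deleted index lies outside the matrix.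
\<close>

fun E :: "nat \<Rightarrow> real" where
  "E 0 = 0" | "E (Suc 0) = 1" | "E (Suc (Suc k)) = \<delta> * E (Suc k) - t ^ 2 * E k"

lemma det_trailing:
  assumes "2 \<le> s" shows "det (mat k k (\<lambda>(i, j). \<kappa> (i + s) (j + s))) = E (Suc k)"
proof (induction k rule: induct_nat_012)
  case 1
  show ?case using assms by (subst det_single) (auto simp: \<kappa>_def)
next
  case (ge2 k)
  have "\<kappa> (Suc k + s) (Suc k + s) = \<delta>" "\<kappa> (k + s) (Suc k + s) = t" "\<kappa> (Suc k + s) (k + s) = t"
    using assms by (simp_all add: \<kappa>_def)
  then show ?case
    using det_tridiagonal_rec[of "\<lambda>i j. \<kappa> (i + s) (j + s)" k] ge2
    by (simp add: \<kappa>_far power2_eq_square)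
qed simp

text \<open>
  The first minors of the tridiagonal matrix.  If \<open>p\<close> or \<open>q\<close> is at least \<open>N\<close>, the truncated
  subtraction leads to \<open>E 0 = 0\<close>, so sums over \<open>p\<close> and \<open>q\<close> may run past the end of the matrix.
\<close>

definition \<mu> :: "nat \<Rightarrow> nat \<Rightarrow> nat \<Rightarrow> real" where
  "\<mu> N p q = D (min p q) * t ^ (max p q - min p q) * E (N - max p q)"

lemma det_minor_\<kappa>:
  assumes "1 \<le> p" "1 \<le> q" "p < N" "q < N"
  shows "det (mat_delete (mat N N (\<lambda>(i, j). \<kappa> i j)) p q) = \<mu> N p q"
proof -
  have le: "det (mat_delete (mat N N (\<lambda>(i, j). \<kappa> i j)) p q) = \<mu> N p q"
    if "1 \<le> p" "p \<le> q" "q < N" for p q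
  proof -
    have "(\<Prod>r = p..<q. \<kappa> (Suc r) r) = t ^ (q - p)"
      using that by (simp add: \<kappa>_def)
    then show ?thesis
      using that det_trailing[of "Suc q" "N - Suc q"] by (subst det_minor_hessenberg)
        (simp_all add: \<kappa>_far D_eq \<mu>_def Suc_diff_Suc)
  qed
  show ?thesis
  proof (cases "p \<le> q")
    case False
    have "mat_delete (mat N N (\<lambda>(i, j). \<kappa> i j)) p q
        = transpose_mat (mat_delete (mat N N (\<lambda>(i, j). \<kappa> i j)) q p)"
      using False assms by (intro eq_matI) (auto simp: mat_delete_def \<kappa>_def)
    then have "det (mat_delete (mat N N (\<lambda>(i, j). \<kappa> i j)) p q)
        = det (mat_delete (mat N N (\<lambda>(i, j). \<kappa> i j)) q p)"
      by (metis det_transpose mat_carrier mat_delete_carrier)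
    also have "\<dots> = \<mu> N p q"
      using False assms by (subst le) (auto simp: \<mu>_def min.commute max.commute)
    finally show ?thesis .
  qed (use le assms in auto)
qed

text \<open>
  The absolute values of the entries \<open>1\<close>, \<open>- 2 u\<close>, \<open>u^2\<close> of a column of \<open>T\<close>: their
  signs cancel against the checkerboard signs of the cofactors.
\<close>

definition wt :: "nat \<Rightarrow> real" where "wt s = (if s = 0 then 1 else if s = 1 then 2 * u else u ^ 2)"

text \<open>
  The hypothesis \<open>2 \<le> i\<close> guarantees that column \<open>i\<close> meets filtered rows only and so shows the
  full pattern \<open>1\<close>, \<open>- 2 u\<close>, \<open>u^2\<close>, cut off at row \<open>N\<close>.
\<close>

lemma T_column_sum:
  assumes i: "2 \<le> i" "i < N" and h: "\<And>p. N \<le> p \<Longrightarrow> h p = 0"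
  shows "(\<Sum>p<N. T N $$ (p, i) * ((-1) ^ p * h p)) = (-1) ^ i * (\<Sum>s<3. wt s * h (i + s))"
proof -
  have "(\<Sum>p<N. T N $$ (p, i) * ((-1) ^ p * h p))
      = (\<Sum>p<N + 3. (if p < N then T N $$ (p, i) else 0) * ((-1) ^ p * h p))"
    by (rule sum.mono_neutral_cong_left) auto
  also have "\<dots> = (\<Sum>p\<in>{i, i + 1, i + 2}. (if p < N then T N $$ (p, i) else 0) * ((-1) ^ p * h p))"
    using i by (intro sum.mono_neutral_right) (auto simp: T_def)
  also have "\<dots> = (-1) ^ i * (\<Sum>s<3. wt s * h (i + s))"
    using i h by (auto simp: T_def wt_def eval_nat_numeral algebra_simps)
  finally show ?thesis .
qed

text \<open>
  The source of all six formulas.  Indices start at 0 here, so \<open>2 \<le> i\<close> is the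
  condition \<open>3 \<le> i\<close> of the theorem.
\<close>

lemma det_minor_R:
  assumes ij: "2 \<le> i" "i < N" "2 \<le> j" "j < N"
  shows "det (mat_delete (R N) i j) = (\<Sum>r<3. \<Sum>s<3. wt r * wt s * \<mu> N (i + r) (j + s))"
proof -
  let ?K = "mat N N (\<lambda>(k, l). \<kappa> k l)"
  have \<mu>0: "\<mu> N p q = 0" if "N \<le> p \<or> N \<le> q" for p q
    using that by (auto simp: \<mu>_def)
  have "cofactor (R N) i j
      = (\<Sum>p<N. \<Sum>q<N. T N $$ (p, i) * transpose_mat (T N) $$ (j, q) * cofactor ?K p q)"
    using cofactor_congruence[OF R_carrier(1) T_carrier(1), of "transpose_mat (T N)" N i j] ij
    by (simp add: det_transpose[of _ N] det_T T_R_T)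
  also have "\<dots> = (\<Sum>p<N. \<Sum>q<N. T N $$ (p, i) * T N $$ (q, j) * ((-1) ^ (p + q) * \<mu> N p q))"
  proof (intro sum.cong refl, goal_cases)
    case (1 p q)
    show ?case
    \<comment> \<open>The corner breaks the Toeplitz pattern, so \<open>\<mu>\<close> does not give the minors
      with \<open>p = 0\<close> or \<open>q = 0\<close>; those have coefficient 0.\<close>
    proof (cases "1 \<le> p \<and> 1 \<le> q")
      case True
      then show ?thesis using 1 ij by (simp add: cofactor_def det_minor_\<kappa>)
    next
      case False
      then have "T N $$ (p, i) * T N $$ (q, j) = 0"
        using 1 ij by (auto simp: T_def)
      then show ?thesis using 1 ij by auto
    qed
  qed
  also have "\<dots> = (\<Sum>p<N. T N $$ (p, i) * ((-1) ^ p * (\<Sum>q<N. T N $$ (q, j) * ((-1) ^ q * \<mu> N p q))))"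
    by (simp add: sum_distrib_left power_add mult_ac)
  also have "\<dots> = (\<Sum>p<N. T N $$ (p, i) * ((-1) ^ p * ((-1) ^ j * (\<Sum>s<3. wt s * \<mu> N p (j + s)))))"
    using ij by (subst T_column_sum) (auto simp: \<mu>0)
  also have "\<dots> = (-1) ^ i * (\<Sum>r<3. wt r * ((-1) ^ j * (\<Sum>s<3. wt s * \<mu> N (i + r) (j + s))))"
    using ij by (subst T_column_sum) (auto simp: \<mu>0)
  also have "\<dots> = (-1) ^ (i + j) * (\<Sum>r<3. \<Sum>s<3. wt r * wt s * \<mu> N (i + r) (j + s))"
    by (simp add: sum_distrib_left power_add mult_ac)
  finally show ?thesis
    by (simp add: cofactor_def)
qed

lemma R_del_small:
  assumes "m < i" "m < j" "m < n" shows "R_del i j m = R m"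
  using assms unfolding R_del_def leading_submat_def
  by (intro eq_matI) (auto simp: mat_delete_def R_def)

text \<open>
  A leading block of size \<open>m\<close> that lacks row \<open>i\<close> and column \<open>j\<close> comes from the first
  \<open>m + 1\<close> rows and columns.  This includes \<open>R_del i (i + 1) i\<close>, where the deleted column is the
  last one.
\<close>

lemma R_del_large:
  assumes "i \<le> Suc m" "j \<le> Suc m" "Suc m \<le> n" "1 \<le> i" "1 \<le> j"
  shows "R_del i j m = mat_delete (R (Suc m)) (i - 1) (j - 1)"
  using assms unfolding R_del_def leading_submat_def
  by (intro eq_matI) (auto simp: mat_delete_def R_def)

section \<open>The constants at a characteristic root\<close>

lemma tau_hat_values:
  "tau_hat (-2) = 2 * t * u"
  "tau_hat (-1) = (1 + w) * u - 3 * (1 + w) * u ^ 3 + 2 * (1 + 2 * w) * u ^ 5"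
  "tau_hat 0 = 1 - 3 * (1 + 2 * w) * u ^ 4 + 2 * (1 + 3 * w) * u ^ 6"
  "tau_hat 1 = (1 + w) * u - 3 * (1 + 3 * w) * u ^ 5 + 2 * (1 + 4 * w) * u ^ 7"
  by (simp_all add: tau_hat_def)

lemma tau_tilde_values:
  "tau_tilde (-2) = t * u / 2"
  "tau_tilde (-1) = 1 / 2 * ((2 * w - 1) * u + (1 + 2 * w) * u ^ 5)"
  "tau_tilde 0 = 1 / 2 * (2 - 3 * (1 + w) * u ^ 2 + (1 + 3 * w) * u ^ 6)"
  by (simp_all add: tau_tilde_def)

definition \<eta> :: real where "\<eta> = w * (1 - u ^ 2) ^ 2"

text \<open>
  The brackets in the constants are \<open>a\<close> plus a multiple of \<open>\<eta>\<close>, and \<open>\<eta>\<close> is the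
  quantity whose quotient by \<open>X\<close> becomes linear in \<open>\<rho>\<close> at a characteristic root.
\<close>

lemma brackets:
  "w * (2 - 6 * u ^ 2 + 4 * u ^ 4) + (1 - u ^ 2) ^ 2 = a + 2 * \<eta>"
  "w * (1 - 4 * u ^ 2 + 3 * u ^ 4) + (1 - u ^ 2) ^ 2 = a + \<eta>"
  "w * (3 - 8 * u ^ 2 + 5 * u ^ 4) + (1 - u ^ 2) ^ 2 = a + 3 * \<eta>"
  unfolding a_def \<eta>_def by (simp_all add: algebra_simps eval_nat_numeral)

lemma t_u_nz: "t \<noteq> 0" "u \<noteq> 0"
  using t_pos u_pos by auto

text \<open>
  Put \<open>S k = (a + k \<eta>) / X \<alpha> + t u \<eta> / X \<alpha>^2\<close>.  At a characteristic root, \<open>C3\<close>, \<open>C7\<close> and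
  \<open>\<sigma>\<close> are the values at \<open>k = 1, 2, 3\<close> of \<open>tau_hat (k - 2) + tau_hat (-2) u^k S k\<close>.  The constants
  \<open>C1\<close>, \<open>C4\<close>, \<open>C6\<close> are, up to a factor, two-term combinations of these three numbers, and in \<open>C2\<close> and
  \<open>C5\<close> the part \<open>\<sigma>'\<close> replaces \<open>\<sigma>\<close>.
\<close>

definition \<sigma> :: "real \<Rightarrow> real" where
  "\<sigma> \<alpha> = tau_hat 1 + 6 * u ^ 3 * (\<rho> \<alpha> - \<delta> - t * u) - 2 * t * u ^ 4"

definition \<sigma>' :: "real \<Rightarrow> real" where
  "\<sigma>' \<alpha> = u * w * (1 - 3 * u ^ 4 + 2 * u ^ 6) + 2 * u ^ 3 * (\<rho> \<alpha> - \<delta> - t * u)"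

context
  fixes \<alpha> :: real
  assumes char_root: "char_root \<alpha>"
begin

lemma X_eq: "X \<alpha> = - (\<rho> \<alpha> + t * u)"
  by (simp add: X_def \<rho>_def)

lemma X_nz: "X \<alpha> \<noteq> 0"
  using char_root t_pos u_pos unfolding X_eq char_root_def by (smt (verit) mult_pos_pos)

text \<open>
  The two roots satisfy \<open>X \<alpha>1 * X \<alpha>2 = t u \<eta>\<close>, so \<open>\<eta> / X \<alpha>\<close> is, up to the factor
  \<open>t u\<close>, the value of \<open>X\<close> at the other root, and \<open>\<delta> - \<rho> \<alpha>\<close> is the other value of \<open>\<rho>\<close>.
\<close>

lemma \<eta>_over_X: "\<eta> / X \<alpha> = (\<rho> \<alpha> - \<delta> - t * u) / (t * u)"
proof -
  have "\<eta> * (t * u) - (\<rho> \<alpha> - \<delta> - t * u) * X \<alpha>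
      = \<rho> \<alpha> ^ 2 - \<delta> * \<rho> \<alpha> + t * u * (\<eta> - \<delta> - t * u)"
    unfolding X_eq by (simp add: algebra_simps eval_nat_numeral)
  also have "\<dots> = - (t ^ 2) + t * u * (\<eta> - \<delta> - t * u)"
    using char_root by (simp add: char_root_def)
  also have "\<dots> = 0"
    unfolding \<eta>_def \<delta>_eq t_eq by (simp add: algebra_simps eval_nat_numeral)
  finally show ?thesis
    using X_nz t_pos u_pos by (simp add: field_simps)
qed

text \<open>
  Every quotient by \<open>X\<close> or \<open>X^2\<close> in the constants enters through this combination or through
  \<open>\<eta> / X\<close>.  The terms \<open>a / X\<close> cancel, and what remains is linear in \<open>\<rho>\<close>.
\<close>

lemma bracket_over_X:
  "(a + k * \<eta>) / X \<alpha> + t * u * (\<eta> / X \<alpha> ^ 2) = k * (\<rho> \<alpha> - \<delta> - t * u) / (t * u) - 1"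
proof -
  have "t * u * (\<eta> / X \<alpha> ^ 2) = t * u * (\<eta> / X \<alpha>) / X \<alpha>"
    by (simp add: power2_eq_square)
  also have "\<dots> = (\<rho> \<alpha> - \<delta> - t * u) / X \<alpha>"
    unfolding \<eta>_over_X using t_pos u_pos by simp
  also have "\<rho> \<alpha> - \<delta> - t * u = - (X \<alpha> + a)"
    unfolding X_eq \<delta>_def by simp
  finally have "t * u * (\<eta> / X \<alpha> ^ 2) = - 1 - a / X \<alpha>"
    using X_nz by (simp add: field_simps)
  moreover have "(a + k * \<eta>) / X \<alpha> = a / X \<alpha> + k * (\<eta> / X \<alpha>)"
    by (simp add: add_divide_distrib)
  ultimately show ?thesis unfolding \<eta>_over_X by simp
qed

lemma C3_eq: "C3 \<alpha> = t + 2 * u * \<rho> \<alpha>"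
proof -
  have "C3 \<alpha> = tau_hat (-1) + tau_hat (-2) * u * ((a + 1 * \<eta>) / X \<alpha> + t * u * (\<eta> / X \<alpha> ^ 2))"
    unfolding C3_def brackets \<eta>_def using X_nz by (simp add: field_simps power2_eq_square)
  also have "\<dots> = tau_hat (-1) + 2 * u * (\<rho> \<alpha> - \<delta> - t * u) - 2 * t * u ^ 2"
    unfolding bracket_over_X using t_u_nz by (simp add: tau_hat_values field_simps power2_eq_square)
  also have "\<dots> = t + 2 * u * \<rho> \<alpha>"
    unfolding tau_hat_values \<delta>_eq t_eq by (simp add: algebra_simps eval_nat_numeral)
  finally show ?thesis .
qed

lemma C7_eq: "C7 \<alpha> = \<delta> + 4 * u * t + 4 * u ^ 2 * \<rho> \<alpha>"
proof -
  have "C7 \<alpha> = tau_hat 0 + tau_hat (-2) * u ^ 2 * ((a + 2 * \<eta>) / X \<alpha> + t * u * (\<eta> / X \<alpha> ^ 2))"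
    unfolding C7_def brackets \<eta>_def using X_nz by (simp add: field_simps eval_nat_numeral)
  also have "\<dots> = tau_hat 0 + 4 * u ^ 2 * (\<rho> \<alpha> - \<delta> - t * u) - 2 * t * u ^ 3"
    unfolding bracket_over_X using t_u_nz by (simp add: tau_hat_values field_simps eval_nat_numeral)
  also have "\<dots> = \<delta> + 4 * u * t + 4 * u ^ 2 * \<rho> \<alpha>"
    unfolding tau_hat_values \<delta>_eq t_eq by (simp add: algebra_simps eval_nat_numeral)
  finally show ?thesis .
qed

lemma C6_eq: "C6 \<alpha> = (t + u * \<rho> \<alpha>) ^ 2"
proof -
  have "C6 \<alpha> = tau_tilde (-1) * C3 \<alpha> - tau_tilde (-2) * C7 \<alpha>"
    unfolding C6_def C3_def C7_def using X_nz by (simp add: field_simps eval_nat_numeral)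
  also have "\<dots> = t ^ 2 + 2 * t * u * \<rho> \<alpha> + u ^ 2 * (\<delta> * \<rho> \<alpha> - t ^ 2)"
    unfolding C3_eq C7_eq tau_tilde_values \<delta>_eq t_eq by (simp add: field_simps eval_nat_numeral)
  also have "\<dots> = (t + u * \<rho> \<alpha>) ^ 2"
    using char_root by (simp add: char_root_def power2_sum power_mult_distrib)
  finally show ?thesis .
qed

lemma \<sigma>_eq: "\<sigma> \<alpha> = tau_hat 1 + tau_hat (-2) * u ^ 3 * ((a + 3 * \<eta>) / X \<alpha> + t * u * (\<eta> / X \<alpha> ^ 2))"
  unfolding \<sigma>_def bracket_over_X using t_u_nz by (simp add: tau_hat_values(1) field_simps eval_nat_numeral)

lemma \<sigma>'_eq: "\<sigma>' \<alpha> = u * w * (1 - 3 * u ^ 4 + 2 * u ^ 6) + tau_hat (-2) * u ^ 3 * (\<eta> / X \<alpha>)"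
  unfolding \<sigma>'_def \<eta>_over_X using t_u_nz by (simp add: tau_hat_values(1) field_simps eval_nat_numeral)

lemma C1_reduce: "t * u ^ 4 * C1 \<alpha> = tau_tilde 0 * C7 \<alpha> - tau_tilde (-1) * \<sigma> \<alpha>"
  unfolding C1_def C7_def \<sigma>_eq brackets \<eta>_def using X_nz t_u_nz by (simp add: field_simps eval_nat_numeral)

lemma C4_reduce: "t * u ^ 4 * C4 \<alpha> = tau_tilde 0 * C3 \<alpha> - tau_tilde (-2) * \<sigma> \<alpha>"
  unfolding C4_def C3_def \<sigma>_eq brackets \<eta>_def using X_nz t_u_nz by (simp add: field_simps eval_nat_numeral)

lemma C2_reduce:
  "t * u ^ 4 * C2 \<alpha> = w * (2 - 3 * u ^ 2 + u ^ 6) / 2 * C7 \<alpha> - tau_tilde (-1) * \<sigma>' \<alpha>"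
  unfolding C2_def C7_def \<sigma>'_eq brackets \<eta>_def using X_nz t_u_nz by (simp add: field_simps eval_nat_numeral)

lemma C5_reduce:
  "t * u ^ 4 * C5 \<alpha> = w * (2 - 3 * u ^ 2 + u ^ 6) / 2 * C3 \<alpha> - tau_tilde (-2) * \<sigma>' \<alpha>"
  unfolding C5_def C3_def \<sigma>'_eq brackets \<eta>_def using X_nz t_u_nz by (simp add: field_simps eval_nat_numeral)

lemma \<rho>_square: "\<rho> \<alpha> ^ 2 = \<delta> * \<rho> \<alpha> - t ^ 2"
  using char_root by (simp add: char_root_def)

lemma C1_eq: "t * u ^ 4 * C1 \<alpha>
  = \<delta> * C7 \<alpha> - t ^ 2 + 2 * u ^ 2 * t ^ 2 + 4 * u ^ 3 * t * \<rho> \<alpha> + u ^ 4 * \<rho> \<alpha> ^ 2"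
  unfolding C1_reduce C7_eq \<rho>_square unfolding \<sigma>_def tau_hat_values tau_tilde_values \<delta>_eq t_eq
  by (simp add: field_simps eval_nat_numeral)

lemma C4_eq: "t * u ^ 4 * C4 \<alpha>
  = \<delta> * C3 \<alpha> + 2 * u * t ^ 2 + 5 * u ^ 2 * t * \<rho> \<alpha> + 2 * u ^ 3 * \<rho> \<alpha> ^ 2"
  unfolding C4_reduce C3_eq \<rho>_square unfolding \<sigma>_def tau_hat_values tau_tilde_values \<delta>_eq t_eq
  by (simp add: field_simps eval_nat_numeral)

text \<open>
  \<open>C2\<close> and \<open>C5\<close> occur only in the differences \<open>C1 - C2\<close> and \<open>C4 - C5\<close>, once the braces of the
  theorem are written in terms of \<open>E\<close>; see \<open>brace_eq_E\<close>.
\<close>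

lemma C1_minus_C2: "u ^ 5 * (C1 \<alpha> - C2 \<alpha>) = - C7 \<alpha>"
proof -
  have "t * (u ^ 5 * (C1 \<alpha> - C2 \<alpha>)) = u * (t * u ^ 4 * C1 \<alpha> - t * u ^ 4 * C2 \<alpha>)"
    by (simp add: algebra_simps eval_nat_numeral)
  also have "\<dots> = t * (- C7 \<alpha>)"
    unfolding C1_eq C2_reduce C7_eq \<rho>_square unfolding \<sigma>'_def tau_tilde_values \<delta>_eq t_eq
    by (simp add: field_simps eval_nat_numeral)
  finally show ?thesis using t_u_nz(1) by (metis mult_left_cancel)
qed

lemma C4_minus_C5: "t * u ^ 5 * (C4 \<alpha> - C5 \<alpha>) = - t * C3 \<alpha> + u ^ 2 * (t + u * \<rho> \<alpha>) ^ 2"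
proof -
  have "t * u ^ 5 * (C4 \<alpha> - C5 \<alpha>) = u * (t * u ^ 4 * C4 \<alpha> - t * u ^ 4 * C5 \<alpha>)"
    by (simp add: algebra_simps eval_nat_numeral)
  also have "\<dots> = - t * C3 \<alpha> + u ^ 2 * (t ^ 2 + 2 * t * u * \<rho> \<alpha> + u ^ 2 * \<rho> \<alpha> ^ 2)"
    unfolding C4_eq C5_reduce C3_eq \<rho>_square unfolding \<sigma>'_def tau_tilde_values \<delta>_eq t_eq
    by (simp add: field_simps eval_nat_numeral)
  finally show ?thesis by (simp add: power2_sum power_mult_distrib)
qed

end

section \<open>Closed forms of the minors\<close>

text \<open>
  Both sides solve the recurrence of the powers of \<open>\<rho>\<close>.  The factor \<open>t / u\<close> arises from
  \<open>\<rho> \<alpha> = - (t / u) \<alpha>\<close>.  Every brace in the theorem has this form once a common power of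
  \<open>\<rho>\<close> is taken out, and so does \<open>D\<close>.
\<close>

lemma E_closed:
  "((c * \<alpha>1 + d) * \<rho> \<alpha>1 ^ s - (c * \<alpha>2 + d) * \<rho> \<alpha>2 ^ s) / (\<alpha>1 - \<alpha>2)
    = c * E (Suc s) - t / u * d * E s" (is "?F s = _")
proof (induction s rule: induct_nat_012)
  case 0
  show ?case using \<alpha>_neq by (simp add: field_simps)
next
  case 1
  have "(c * \<alpha>1 + d) * \<rho> \<alpha>1 - (c * \<alpha>2 + d) * \<rho> \<alpha>2
      = (\<alpha>1 - \<alpha>2) * (c * (\<rho> \<alpha>1 + \<rho> \<alpha>2) - t / u * d)"
    by (simp add: \<rho>_eq divide_inverse algebra_simps)
  then show ?case using \<alpha>_neq by (simp add: \<rho>_sum mult.commute)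
next
  case (ge2 s)
  have step: "\<rho> \<alpha> ^ Suc (Suc s) = \<delta> * \<rho> \<alpha> ^ Suc s - t ^ 2 * \<rho> \<alpha> ^ s" if "char_root \<alpha>" for \<alpha>
  proof -
    have "\<rho> \<alpha> ^ Suc (Suc s) = \<rho> \<alpha> ^ 2 * \<rho> \<alpha> ^ s"
      by (simp add: power2_eq_square)
    also have "\<dots> = (\<delta> * \<rho> \<alpha> - t ^ 2) * \<rho> \<alpha> ^ s"
      using that by (simp add: char_root_def)
    finally show ?thesis
      by (simp add: algebra_simps)
  qed
  have "?F (Suc (Suc s)) = \<delta> * ?F (Suc s) - t ^ 2 * ?F s"
    unfolding step[OF char_root_\<alpha>(1)] step[OF char_root_\<alpha>(2)]
    by (simp add: divide_inverse algebra_simps)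
  then show ?case
    unfolding ge2 by (simp add: algebra_simps)
qed

text \<open>
  The amplitudes of the two powers in the leading minors \<open>D\<close>.
\<close>

definition amp :: "real \<Rightarrow> real" where
  "amp \<alpha> = (a_tilde * \<alpha> + u ^ 2 * b_tilde) / (\<alpha>1 - \<alpha>2)"

lemma D_closed: "D (k + 2) = amp \<alpha>1 * \<rho> \<alpha>1 ^ k - amp \<alpha>2 * \<rho> \<alpha>2 ^ k"
proof -
  have "D (k + 2) = a_tilde * E (Suc k) - t ^ 2 * E k"
  proof (induction k rule: induct_nat_012)
    case 0
    then show ?case by (simp add: D_base flip: numeral_2_eq_2)
  next
    case 1
    then show ?case using D_step[of 1] D_base by (simp add: eval_nat_numeral)
  next
    case (ge2 k)
    have "D (Suc (Suc k) + 2) = \<delta> * D (Suc k + 2) - t ^ 2 * D (k + 2)"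
      using D_step[of "k + 2"] by simp
    then show ?case unfolding ge2 by (simp add: algebra_simps eval_nat_numeral)
  qed
  also have "\<dots> = a_tilde * E (Suc k) - t / u * (u ^ 2 * b_tilde) * E k"
    using u_pos by (simp add: b_tilde_eq power2_eq_square)
  also have "\<dots> = amp \<alpha>1 * \<rho> \<alpha>1 ^ k - amp \<alpha>2 * \<rho> \<alpha>2 ^ k"
    unfolding E_closed[symmetric] by (simp add: amp_def diff_divide_distrib)
  finally show ?thesis .
qed

text \<open>
  How the six formulas arise: replacing \<open>D (p + 2 + k)\<close> by \<open>\<rho>^k\<close> in the sum of minors gives the
  coefficient of \<open>amp \<alpha> * \<rho>^p\<close>, separately for each root.
\<close>

lemma D_combination:
  "x0 * D (p + 2) + x1 * D (p + 3) + x2 * D (p + 4)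
    = amp \<alpha>1 * \<rho> \<alpha>1 ^ p * (x0 + x1 * \<rho> \<alpha>1 + x2 * \<rho> \<alpha>1 ^ 2)
      - amp \<alpha>2 * \<rho> \<alpha>2 ^ p * (x0 + x1 * \<rho> \<alpha>2 + x2 * \<rho> \<alpha>2 ^ 2)"
proof -
  have 3: "D (p + 3) = amp \<alpha>1 * \<rho> \<alpha>1 ^ (p + 1) - amp \<alpha>2 * \<rho> \<alpha>2 ^ (p + 1)"
    using D_closed[of "p + 1"] by (simp add: numeral_eq_Suc)
  have 4: "D (p + 4) = amp \<alpha>1 * \<rho> \<alpha>1 ^ (p + 2) - amp \<alpha>2 * \<rho> \<alpha>2 ^ (p + 2)"
    using D_closed[of "p + 2"] by (simp add: numeral_eq_Suc)
  show ?thesis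
    unfolding D_closed[of p] 3 4 by (simp add: power_add power2_eq_square algebra_simps)
qed

lemma det_R_del_R:
  assumes "m < i" "m < j" "m < n" shows "det (R_del i j m) = det (R m)"
  using R_del_small assms by simp

lemma det_R_del_diag_last:
  assumes "3 \<le> i" "i \<le> n - 1"
  shows "det (R_del i i i) = C7 \<alpha>1 * amp \<alpha>1 * \<rho> \<alpha>1 ^ (i - 3) - C7 \<alpha>2 * amp \<alpha>2 * \<rho> \<alpha>2 ^ (i - 3)"
proof -
  obtain p where p: "i = p + 3" using assms(1) by (metis add.commute le_Suc_ex)
  have "det (R_del i i i) = det (mat_delete (R (p + 4)) (p + 2) (p + 2))"
    using assms by (subst R_del_large) (simp_all add: p eval_nat_numeral)
  also have "\<dots> = (\<delta> + 4 * u * t) * D (p + 2) + 4 * u ^ 2 * D (p + 3) + 0 * D (p + 4)"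
    by (subst det_minor_R) (simp_all add: \<mu>_def wt_def eval_nat_numeral algebra_simps)
  finally show ?thesis
    unfolding D_combination by (simp add: C7_eq char_root_\<alpha> p mult_ac)
qed

lemma det_R_del_superdiag_last:
  assumes "3 \<le> i" "i \<le> n - 1"
  shows "det (R_del i (i + 1) i) = C3 \<alpha>1 * amp \<alpha>1 * \<rho> \<alpha>1 ^ (i - 3) - C3 \<alpha>2 * amp \<alpha>2 * \<rho> \<alpha>2 ^ (i - 3)"
proof -
  obtain p where p: "i = p + 3" using assms(1) by (metis add.commute le_Suc_ex)
  have "det (R_del i (i + 1) i) = det (mat_delete (R (p + 4)) (p + 2) (p + 3))"
    using assms by (subst R_del_large) (simp_all add: p eval_nat_numeral)
  also have "\<dots> = t * D (p + 2) + 2 * u * D (p + 3) + 0 * D (p + 4)"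
    by (subst det_minor_R) (simp_all add: \<mu>_def wt_def eval_nat_numeral algebra_simps)
  finally show ?thesis
    unfolding D_combination by (simp add: C3_eq char_root_\<alpha> p mult_ac)
qed

lemma brace_eq_E:
  "t * u ^ 4 * x * (((\<alpha>1 - u ^ 2) * \<rho> \<alpha>1 ^ s - (\<alpha>2 - u ^ 2) * \<rho> \<alpha>2 ^ s) / (\<alpha>1 - \<alpha>2))
    + t * u ^ 6 * z * ((\<rho> \<alpha>1 ^ s - \<rho> \<alpha>2 ^ s) / (\<alpha>1 - \<alpha>2))
   = t * u ^ 4 * x * E (Suc s) + t ^ 2 * u ^ 5 * (x - z) * E s"
proof -
  have 1: "((\<alpha>1 - u ^ 2) * \<rho> \<alpha>1 ^ s - (\<alpha>2 - u ^ 2) * \<rho> \<alpha>2 ^ s) / (\<alpha>1 - \<alpha>2)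
      = E (Suc s) + t / u * u ^ 2 * E s"
    using E_closed[of 1 "- (u ^ 2)" s] by simp
  have 2: "(\<rho> \<alpha>1 ^ s - \<rho> \<alpha>2 ^ s) / (\<alpha>1 - \<alpha>2) = - (t / u * E s)"
    using E_closed[of 0 1 s] by simp
  show ?thesis
    unfolding 1 2 using u_pos by (simp add: field_simps eval_nat_numeral)
qed

text \<open>
  The common shape of the formulas for \<open>R_del i i m\<close> and \<open>R_del i (i + 1) m\<close>, with
  \<open>(c, c')\<close> standing for \<open>(C1, C2)\<close> and \<open>(C4, C5)\<close>.  The left-hand side is what
  \<open>D_combination\<close> produces.
\<close>

lemma two_mode_expansion:
  fixes c c' :: "real \<Rightarrow> real"
  shows "amp \<alpha>1 * \<rho> \<alpha>1 ^ p * (t * u ^ 4 * c \<alpha>1 * E (Suc s) + t ^ 2 * u ^ 5 * (c \<alpha>1 - c' \<alpha>1) * E s)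
      - amp \<alpha>2 * \<rho> \<alpha>2 ^ p * (t * u ^ 4 * c \<alpha>2 * E (Suc s) + t ^ 2 * u ^ 5 * (c \<alpha>2 - c' \<alpha>2) * E s)
    = c \<alpha>1 * t * u ^ 4 * (a_tilde * \<alpha>1 + u ^ 2 * b_tilde) / (\<alpha>1 - \<alpha>2) ^ 2
        * ((\<alpha>1 - u ^ 2) * \<rho> \<alpha>1 ^ (p + s) - (\<alpha>2 - u ^ 2) * \<rho> \<alpha>1 ^ p * \<rho> \<alpha>2 ^ s)
      - c \<alpha>2 * t * u ^ 4 * (a_tilde * \<alpha>2 + u ^ 2 * b_tilde) / (\<alpha>1 - \<alpha>2) ^ 2
        * ((\<alpha>1 - u ^ 2) * \<rho> \<alpha>1 ^ s * \<rho> \<alpha>2 ^ p - (\<alpha>2 - u ^ 2) * \<rho> \<alpha>2 ^ (p + s))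
      + c' \<alpha>1 * t * u ^ 6 * (a_tilde * \<alpha>1 + u ^ 2 * b_tilde) / (\<alpha>1 - \<alpha>2) ^ 2
        * (\<rho> \<alpha>1 ^ (p + s) - \<rho> \<alpha>1 ^ p * \<rho> \<alpha>2 ^ s)
      - c' \<alpha>2 * t * u ^ 6 * (a_tilde * \<alpha>2 + u ^ 2 * b_tilde) / (\<alpha>1 - \<alpha>2) ^ 2
        * (\<rho> \<alpha>1 ^ s * \<rho> \<alpha>2 ^ p - \<rho> \<alpha>2 ^ (p + s))"
proof -
  \<comment> \<open>Naming the difference prevents its square from being expanded inside the denominators.\<close>
  define q where "q = \<alpha>1 - \<alpha>2"
  show ?thesis
    unfolding brace_eq_E[symmetric] amp_def q_def[symmetric]
    by (simp add: divide_inverse power_add power2_eq_square algebra_simps)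
qed

lemma det_R_del_diag:
  assumes "4 \<le> i + 1" "i + 1 \<le> m" "m \<le> n - 1"
  shows "det (R_del i i m) =
      C1 \<alpha>1 * t * u ^ 4 * (a_tilde * \<alpha>1 + u ^ 2 * b_tilde) / (\<alpha>1 - \<alpha>2) ^ 2
        * ((\<alpha>1 - u ^ 2) * \<rho> \<alpha>1 ^ (m - 4) - (\<alpha>2 - u ^ 2) * \<rho> \<alpha>1 ^ (i - 3) * \<rho> \<alpha>2 ^ (m - i - 1))
      - C1 \<alpha>2 * t * u ^ 4 * (a_tilde * \<alpha>2 + u ^ 2 * b_tilde) / (\<alpha>1 - \<alpha>2) ^ 2
        * ((\<alpha>1 - u ^ 2) * \<rho> \<alpha>1 ^ (m - i - 1) * \<rho> \<alpha>2 ^ (i - 3) - (\<alpha>2 - u ^ 2) * \<rho> \<alpha>2 ^ (m - 4))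
      + C2 \<alpha>1 * t * u ^ 6 * (a_tilde * \<alpha>1 + u ^ 2 * b_tilde) / (\<alpha>1 - \<alpha>2) ^ 2
        * (\<rho> \<alpha>1 ^ (m - 4) - \<rho> \<alpha>1 ^ (i - 3) * \<rho> \<alpha>2 ^ (m - i - 1))
      - C2 \<alpha>2 * t * u ^ 6 * (a_tilde * \<alpha>2 + u ^ 2 * b_tilde) / (\<alpha>1 - \<alpha>2) ^ 2
        * (\<rho> \<alpha>1 ^ (m - i - 1) * \<rho> \<alpha>2 ^ (i - 3) - \<rho> \<alpha>2 ^ (m - 4))"
proof -
  obtain p where p: "i = p + 3" using assms(1) by (auto dest: le_Suc_ex)
  obtain s where s: "m = p + 4 + s" using assms(2) by (auto simp: p dest: le_Suc_ex)
  have "det (R_del i i m) = det (mat_delete (R (p + 5 + s)) (p + 2) (p + 2))"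
    using assms by (subst R_del_large) (simp_all add: p s eval_nat_numeral)
  also have "\<dots> = (E (s + 3) + 4 * u * t * E (s + 2) + 2 * u ^ 2 * t ^ 2 * E (s + 1)) * D (p + 2)
      + (4 * u ^ 2 * E (s + 2) + 4 * u ^ 3 * t * E (s + 1)) * D (p + 3)
      + u ^ 4 * E (s + 1) * D (p + 4)"
    by (subst det_minor_R) (simp_all add: \<mu>_def wt_def eval_nat_numeral algebra_simps del: E.simps)
  also have "\<dots> = amp \<alpha>1 * \<rho> \<alpha>1 ^ p * (t * u ^ 4 * C1 \<alpha>1 * E (Suc s) + t ^ 2 * u ^ 5 * (C1 \<alpha>1 - C2 \<alpha>1) * E s)
      - amp \<alpha>2 * \<rho> \<alpha>2 ^ p * (t * u ^ 4 * C1 \<alpha>2 * E (Suc s) + t ^ 2 * u ^ 5 * (C1 \<alpha>2 - C2 \<alpha>2) * E s)"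
  proof -
    have "E (s + 3) + 4 * u * t * E (s + 2) + 2 * u ^ 2 * t ^ 2 * E (s + 1)
          + (4 * u ^ 2 * E (s + 2) + 4 * u ^ 3 * t * E (s + 1)) * \<rho> \<alpha> + u ^ 4 * E (s + 1) * \<rho> \<alpha> ^ 2
        = t * u ^ 4 * C1 \<alpha> * E (Suc s) + t ^ 2 * u ^ 5 * (C1 \<alpha> - C2 \<alpha>) * E s" if "char_root \<alpha>" for \<alpha>
    proof -
      have eq: "t ^ 2 * u ^ 5 * (C1 \<alpha> - C2 \<alpha>) = - (t ^ 2 * C7 \<alpha>)"
        using C1_minus_C2[OF that] by (simp add: mult.assoc)
      show ?thesis
        unfolding eq C1_eq[OF that] C7_eq[OF that] by (simp add: algebra_simps eval_nat_numeral)
    qed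
    then show ?thesis
      unfolding D_combination using char_root_\<alpha> by presburger
  qed
  finally show ?thesis
    unfolding two_mode_expansion by (simp add: p s)
qed

lemma det_R_del_superdiag:
  assumes "4 \<le> i + 1" "i + 1 \<le> m" "m \<le> n - 1"
  shows "det (R_del i (i + 1) m) =
      C4 \<alpha>1 * t * u ^ 4 * (a_tilde * \<alpha>1 + u ^ 2 * b_tilde) / (\<alpha>1 - \<alpha>2) ^ 2
        * ((\<alpha>1 - u ^ 2) * \<rho> \<alpha>1 ^ (m - 4) - (\<alpha>2 - u ^ 2) * \<rho> \<alpha>1 ^ (i - 3) * \<rho> \<alpha>2 ^ (m - i - 1))
      - C4 \<alpha>2 * t * u ^ 4 * (a_tilde * \<alpha>2 + u ^ 2 * b_tilde) / (\<alpha>1 - \<alpha>2) ^ 2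
        * ((\<alpha>1 - u ^ 2) * \<rho> \<alpha>1 ^ (m - i - 1) * \<rho> \<alpha>2 ^ (i - 3) - (\<alpha>2 - u ^ 2) * \<rho> \<alpha>2 ^ (m - 4))
      + C5 \<alpha>1 * t * u ^ 6 * (a_tilde * \<alpha>1 + u ^ 2 * b_tilde) / (\<alpha>1 - \<alpha>2) ^ 2
        * (\<rho> \<alpha>1 ^ (m - 4) - \<rho> \<alpha>1 ^ (i - 3) * \<rho> \<alpha>2 ^ (m - i - 1))
      - C5 \<alpha>2 * t * u ^ 6 * (a_tilde * \<alpha>2 + u ^ 2 * b_tilde) / (\<alpha>1 - \<alpha>2) ^ 2
        * (\<rho> \<alpha>1 ^ (m - i - 1) * \<rho> \<alpha>2 ^ (i - 3) - \<rho> \<alpha>2 ^ (m - 4))"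
proof -
  obtain p where p: "i = p + 3" using assms(1) by (auto dest: le_Suc_ex)
  obtain s where s: "m = p + 4 + s" using assms(2) by (auto simp: p dest: le_Suc_ex)
  have "det (R_del i (i + 1) m) = det (mat_delete (R (p + 5 + s)) (p + 2) (p + 3))"
    using assms by (subst R_del_large) (simp_all add: p s eval_nat_numeral)
  also have "\<dots> = (t * E (s + 2) + 2 * u * t ^ 2 * E (s + 1) + u ^ 2 * t ^ 3 * E s) * D (p + 2)
      + (2 * u * E (s + 2) + 5 * u ^ 2 * t * E (s + 1) + 2 * u ^ 3 * t ^ 2 * E s) * D (p + 3)
      + (2 * u ^ 3 * E (s + 1) + u ^ 4 * t * E s) * D (p + 4)"
    by (subst det_minor_R) (simp_all add: \<mu>_def wt_def eval_nat_numeral algebra_simps del: E.simps)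
  also have "\<dots> = amp \<alpha>1 * \<rho> \<alpha>1 ^ p * (t * u ^ 4 * C4 \<alpha>1 * E (Suc s) + t ^ 2 * u ^ 5 * (C4 \<alpha>1 - C5 \<alpha>1) * E s)
      - amp \<alpha>2 * \<rho> \<alpha>2 ^ p * (t * u ^ 4 * C4 \<alpha>2 * E (Suc s) + t ^ 2 * u ^ 5 * (C4 \<alpha>2 - C5 \<alpha>2) * E s)"
  proof -
    have "t * E (s + 2) + 2 * u * t ^ 2 * E (s + 1) + u ^ 2 * t ^ 3 * E s
          + (2 * u * E (s + 2) + 5 * u ^ 2 * t * E (s + 1) + 2 * u ^ 3 * t ^ 2 * E s) * \<rho> \<alpha>
          + (2 * u ^ 3 * E (s + 1) + u ^ 4 * t * E s) * \<rho> \<alpha> ^ 2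
        = t * u ^ 4 * C4 \<alpha> * E (Suc s) + t ^ 2 * u ^ 5 * (C4 \<alpha> - C5 \<alpha>) * E s" if "char_root \<alpha>" for \<alpha>
    proof -
      have eq: "t ^ 2 * u ^ 5 * (C4 \<alpha> - C5 \<alpha>) = t * (- t * C3 \<alpha> + u ^ 2 * (t + u * \<rho> \<alpha>) ^ 2)"
        unfolding C4_minus_C5[OF that, symmetric] by (simp add: power2_eq_square)
      show ?thesis
        unfolding eq C4_eq[OF that] C3_eq[OF that] by (simp add: algebra_simps eval_nat_numeral)
    qed
    then show ?thesis
      unfolding D_combination using char_root_\<alpha> by presburger
  qed
  finally show ?thesis
    unfolding two_mode_expansion by (simp add: p s)
qed

text \<open>
  With \<open>j = n\<close> the sum over the columns reduces to the single term \<open>q = n - 1\<close>, and the sum over the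
  rows is the expanded square \<open>C6 = (t + u \<rho>)^2\<close>.
\<close>

lemma det_R_del_last_column:
  assumes "3 \<le> i" "i \<le> n - 2"
  shows "det (R_del i n (n - 1))
    = C6 \<alpha>1 * t ^ (n - i - 2) * amp \<alpha>1 * \<rho> \<alpha>1 ^ (i - 3) - C6 \<alpha>2 * t ^ (n - i - 2) * amp \<alpha>2 * \<rho> \<alpha>2 ^ (i - 3)"
proof -
  obtain p where p: "i = p + 3" using assms(1) by (metis add.commute le_Suc_ex)
  define k where "k = n - i - 2"
  have k: "n = p + 5 + k"
    using assms by (simp add: k_def p)
  have "det (R_del i n (n - 1)) = det (mat_delete (R (p + 5 + k)) (p + 2) (p + 4 + k))"
    using assms by (subst R_del_large) (simp_all add: p k eval_nat_numeral)
  also have "\<dots> = t ^ k * t ^ 2 * D (p + 2) + t ^ k * 2 * u * t * D (p + 3) + t ^ k * u ^ 2 * D (p + 4)"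
    by (subst det_minor_R) (simp_all add: \<mu>_def wt_def eval_nat_numeral algebra_simps Suc_diff_le)
  finally show ?thesis
    unfolding D_combination
    by (simp add: C6_eq char_root_\<alpha> p k_def algebra_simps power2_eq_square)
qed

text \<open>
  For \<open>i + 2 \<le> j\<close> all row indices of the nine minors are at most all column indices, so the double
  sum factors into a row sum, which gives \<open>C6\<close>, and a column sum, which gives the brace.
\<close>

lemma det_R_del_off_diag:
  assumes "5 \<le> i + 2" "i + 2 \<le> j" "j \<le> n - 1"
  shows "det (R_del i j (n - 1)) =
      C6 \<alpha>1 * t ^ (j - i - 2) * (a_tilde * \<alpha>1 + u ^ 2 * b_tilde) / (\<alpha>1 - \<alpha>2) ^ 2
        * ((a * \<alpha>1 + u ^ 2 * b) * \<rho> \<alpha>1 ^ (n - j + i - 4)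
           - (a * \<alpha>2 + u ^ 2 * b) * \<rho> \<alpha>1 ^ (i - 3) * \<rho> \<alpha>2 ^ (n - j - 1))
      - C6 \<alpha>2 * t ^ (j - i - 2) * (a_tilde * \<alpha>2 + u ^ 2 * b_tilde) / (\<alpha>1 - \<alpha>2) ^ 2
        * ((a * \<alpha>1 + u ^ 2 * b) * \<rho> \<alpha>1 ^ (n - j - 1) * \<rho> \<alpha>2 ^ (i - 3)
           - (a * \<alpha>2 + u ^ 2 * b) * \<rho> \<alpha>2 ^ (n - j + i - 4))"
proof -
  define p where "p = i - 3"
  define k where "k = j - i - 2"
  define s where "s = n - j - 1"
  have ijn: "i = p + 3" "j = p + 5 + k" "n = p + 6 + k + s"
    using assms by (auto simp: p_def k_def s_def)
  have brace: "((a * \<alpha>1 + u ^ 2 * b) * \<rho> \<alpha>1 ^ s - (a * \<alpha>2 + u ^ 2 * b) * \<rho> \<alpha>2 ^ s) / (\<alpha>1 - \<alpha>2)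
      = E (s + 2) + 2 * u * t * E (s + 1) + u ^ 2 * t ^ 2 * E s"
  proof -
    have b: "b = t / u - t * u" using b_eq by simp
    have *: "t / u * (u ^ 2 * b) = t ^ 2 * (1 - u ^ 2)"
      using u_pos unfolding b by (simp add: field_simps power2_eq_square)
    show ?thesis
      unfolding E_closed * by (simp add: \<delta>_def algebra_simps eval_nat_numeral)
  qed
  have "det (R_del i j (n - 1)) = det (mat_delete (R (p + 6 + k + s)) (p + 2) (p + 4 + k))"
    using assms by (subst R_del_large) (simp_all add: ijn eval_nat_numeral)
  also have "\<dots> = (E (s + 2) + 2 * u * t * E (s + 1) + u ^ 2 * t ^ 2 * E s) * t ^ k
       * (t ^ 2 * D (p + 2) + 2 * u * t * D (p + 3) + u ^ 2 * D (p + 4))"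
    by (subst det_minor_R)
       (simp_all add: \<mu>_def wt_def eval_nat_numeral algebra_simps Suc_diff_le del: E.simps)
  also have "\<dots> = (E (s + 2) + 2 * u * t * E (s + 1) + u ^ 2 * t ^ 2 * E s) * t ^ k
       * (amp \<alpha>1 * \<rho> \<alpha>1 ^ p * C6 \<alpha>1 - amp \<alpha>2 * \<rho> \<alpha>2 ^ p * C6 \<alpha>2)"
    unfolding D_combination by (simp add: C6_eq char_root_\<alpha> power2_sum power_mult_distrib algebra_simps)
  finally have "det (R_del i j (n - 1)) = \<dots>" .
  moreover have "n - j + i - 4 = p + s" using ijn by simp
  moreover define q where "q = \<alpha>1 - \<alpha>2"
  ultimately show ?thesis
    unfolding brace[symmetric] amp_def p_def[symmetric] k_def[symmetric] s_def[symmetric] q_def[symmetric]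
    by (simp add: divide_inverse power_add power2_eq_square algebra_simps)
qed

end

theorem theorem4:
  fixes \<theta> :: real and n :: nat
  assumes "0 < n" and "0 < \<theta>"
  defines "R \<equiv> matern32.R \<theta> n"
    and "R_del \<equiv> matern32.R_del \<theta> n"
    and "u \<equiv> matern32.u \<theta> n"
    and "t \<equiv> matern32.tau \<theta> n (-1)"
    and "a \<equiv> matern32.a \<theta> n"
    and "b \<equiv> matern32.b \<theta> n"
    and "a' \<equiv> matern32.a_tilde \<theta> n"
    and "b' \<equiv> matern32.b_tilde \<theta> n"
    and "\<alpha>1 \<equiv> matern32.\<alpha>1 \<theta> n"
    and "\<alpha>2 \<equiv> matern32.\<alpha>2 \<theta> n"
    and "C1 \<equiv> matern32.C1 \<theta> n"
    and "C2 \<equiv> matern32.C2 \<theta> n"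
    and "C3 \<equiv> matern32.C3 \<theta> n"
    and "C4 \<equiv> matern32.C4 \<theta> n"
    and "C5 \<equiv> matern32.C5 \<theta> n"
    and "C6 \<equiv> matern32.C6 \<theta> n"
    and "C7 \<equiv> matern32.C7 \<theta> n"
  defines "\<rho>1 \<equiv> - ((b + t * u) * \<alpha>1)"
    and "\<rho>2 \<equiv> - ((b + t * u) * \<alpha>2)"
  shows
   "(\<forall>i. 3 \<le> i \<and> i \<le> n - 1 \<longrightarrow>
      (\<forall>m. 1 \<le> m \<and> m \<le> i - 1 \<longrightarrow> det (R_del i i m) = det (R m)) \<and>
      det (R_del i i i) =
          C7 \<alpha>1 * (a' * \<alpha>1 + u ^ 2 * b') / (\<alpha>1 - \<alpha>2) * \<rho>1 ^ (i - 3)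
        - C7 \<alpha>2 * (a' * \<alpha>2 + u ^ 2 * b') / (\<alpha>1 - \<alpha>2) * \<rho>2 ^ (i - 3))
    \<and>
    (\<forall>i m. 4 \<le> i + 1 \<and> i + 1 \<le> m \<and> m \<le> n - 1 \<longrightarrow>
      det (R_del i i m) =
          C1 \<alpha>1 * t * u ^ 4 * (a' * \<alpha>1 + u ^ 2 * b') / (\<alpha>1 - \<alpha>2) ^ 2
            * ((\<alpha>1 - u ^ 2) * \<rho>1 ^ (m - 4)
               - (\<alpha>2 - u ^ 2) * \<rho>1 ^ (i - 3) * \<rho>2 ^ (m - i - 1))
        - C1 \<alpha>2 * t * u ^ 4 * (a' * \<alpha>2 + u ^ 2 * b') / (\<alpha>1 - \<alpha>2) ^ 2
            * ((\<alpha>1 - u ^ 2) * \<rho>1 ^ (m - i - 1) * \<rho>2 ^ (i - 3)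
               - (\<alpha>2 - u ^ 2) * \<rho>2 ^ (m - 4))
        + C2 \<alpha>1 * t * u ^ 6 * (a' * \<alpha>1 + u ^ 2 * b') / (\<alpha>1 - \<alpha>2) ^ 2
            * (\<rho>1 ^ (m - 4) - \<rho>1 ^ (i - 3) * \<rho>2 ^ (m - i - 1))
        - C2 \<alpha>2 * t * u ^ 6 * (a' * \<alpha>2 + u ^ 2 * b') / (\<alpha>1 - \<alpha>2) ^ 2
            * (\<rho>1 ^ (m - i - 1) * \<rho>2 ^ (i - 3) - \<rho>2 ^ (m - 4)))
    \<and>
    (\<forall>i. 3 \<le> i \<and> i \<le> n - 1 \<longrightarrow>
      (\<forall>m. 1 \<le> m \<and> m \<le> i - 1 \<longrightarrow> det (R_del i (i + 1) m) = det (R m)) \<and>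
      det (R_del i (i + 1) i) =
          C3 \<alpha>1 * (a' * \<alpha>1 + u ^ 2 * b') / (\<alpha>1 - \<alpha>2) * \<rho>1 ^ (i - 3)
        - C3 \<alpha>2 * (a' * \<alpha>2 + u ^ 2 * b') / (\<alpha>1 - \<alpha>2) * \<rho>2 ^ (i - 3))
    \<and>
    (\<forall>i m. 4 \<le> i + 1 \<and> i + 1 \<le> m \<and> m \<le> n - 1 \<longrightarrow>
      det (R_del i (i + 1) m) =
          C4 \<alpha>1 * t * u ^ 4 * (a' * \<alpha>1 + u ^ 2 * b') / (\<alpha>1 - \<alpha>2) ^ 2
            * ((\<alpha>1 - u ^ 2) * \<rho>1 ^ (m - 4)
               - (\<alpha>2 - u ^ 2) * \<rho>1 ^ (i - 3) * \<rho>2 ^ (m - i - 1))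
        - C4 \<alpha>2 * t * u ^ 4 * (a' * \<alpha>2 + u ^ 2 * b') / (\<alpha>1 - \<alpha>2) ^ 2
            * ((\<alpha>1 - u ^ 2) * \<rho>1 ^ (m - i - 1) * \<rho>2 ^ (i - 3)
               - (\<alpha>2 - u ^ 2) * \<rho>2 ^ (m - 4))
        + C5 \<alpha>1 * t * u ^ 6 * (a' * \<alpha>1 + u ^ 2 * b') / (\<alpha>1 - \<alpha>2) ^ 2
            * (\<rho>1 ^ (m - 4) - \<rho>1 ^ (i - 3) * \<rho>2 ^ (m - i - 1))
        - C5 \<alpha>2 * t * u ^ 6 * (a' * \<alpha>2 + u ^ 2 * b') / (\<alpha>1 - \<alpha>2) ^ 2
            * (\<rho>1 ^ (m - i - 1) * \<rho>2 ^ (i - 3) - \<rho>2 ^ (m - 4)))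
    \<and>
    (\<forall>i. 3 \<le> i \<and> i \<le> n - 2 \<longrightarrow>
      det (R_del i n (n - 1)) =
          C6 \<alpha>1 * t ^ (n - i - 2) * (a' * \<alpha>1 + u ^ 2 * b') / (\<alpha>1 - \<alpha>2) * \<rho>1 ^ (i - 3)
        - C6 \<alpha>2 * t ^ (n - i - 2) * (a' * \<alpha>2 + u ^ 2 * b') / (\<alpha>1 - \<alpha>2) * \<rho>2 ^ (i - 3))
    \<and>
    (\<forall>i j. 5 \<le> i + 2 \<and> i + 2 \<le> j \<and> j \<le> n - 1 \<longrightarrow>
      det (R_del i j (n - 1)) =
          C6 \<alpha>1 * t ^ (j - i - 2) * (a' * \<alpha>1 + u ^ 2 * b') / (\<alpha>1 - \<alpha>2) ^ 2
            * ((a * \<alpha>1 + u ^ 2 * b) * \<rho>1 ^ (n - j + i - 4)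
               - (a * \<alpha>2 + u ^ 2 * b) * \<rho>1 ^ (i - 3) * \<rho>2 ^ (n - j - 1))
        - C6 \<alpha>2 * t ^ (j - i - 2) * (a' * \<alpha>2 + u ^ 2 * b') / (\<alpha>1 - \<alpha>2) ^ 2
            * ((a * \<alpha>1 + u ^ 2 * b) * \<rho>1 ^ (n - j - 1) * \<rho>2 ^ (i - 3)
               - (a * \<alpha>2 + u ^ 2 * b) * \<rho>2 ^ (n - j + i - 4)))"
proof -
  interpret matern32_pos \<theta> n
    using assms(1,2) by unfold_locales
  show ?thesis
    unfolding assms(3-21) \<rho>_def[symmetric]
    using det_R_del_diag_last det_R_del_diag det_R_del_superdiag_last det_R_del_superdiag det_R_del_last_column det_R_del_off_diag det_R_del_R
    by (auto simp: amp_def)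
qed

end
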